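(* Let $\mathcal{P}$ be an arbitrary nonempty family of nonempty subsets of $\{1,\dots,K\}$ and suppose that the thresholds of the G-SLRT $(\hat\tau,\hat d)$ are selected as $b=|\log(\alpha/|\mathcal{P}|)|$ and $a=|\log\beta|$, where $\alpha,\beta\in(0,1)$. Suppose that for every $1\le k\le K$ the log-likelihood ratio increments $\ell_t^k=Z_t^k-Z_{t-1}^k$, $t\in\mathbb{N}$ ($Z_0^k=0$), are independent over time (not necessarily identically distributed) under $\mathsf{P}_0^k$ and under $\mathsf{P}_1^k$, and that there are positive and finite numbers $I_0^k,I_1^k$ such that $$\mathsf{P}_1^k\Big(\tfrac1t Z_t^k\to I_1^k \text{ as } t\to\infty\Big)=1,\qquad \mathsf{P}_0^k\Big(\tfrac1t Z_t^k\to -I_0^k\text{ as } t\to\infty\Big)=1,\qquad 1\le k\le K .$$ For $\mathcal{A}\subset\{1,\dots,K\}$ put $I_i^{\mathcal{A}}=\sum_{k\in\mathcal{A}}I_i^k$, $i=0,1$. Then for every $q\in\mathbb{N}$, as $\max(\alpha,\beta)\to0$, $$\mathsf{E}_0[\hat\tau^q]\sim\Big(\frac{|\log\beta|}{\min_{\mathcal{A}\in\mathcal{P}}I_0^{\mathcal{A}}}\Big)^q\sim\inf_{(\tau,d)\in\mathcal{C}_{\alpha,\beta}(\mathcal{P})}\mathsf{E}_0[\tau^q],$$ and for every $\mathcal{A}\in\mathcal{P}$ $$\mathsf{E}^{\mathcal{A}}[\hat\tau^q]\sim\Big(\frac{|\log\alpha|}{I_1^{\mathcal{A}}}\Big)^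q\sim\inf_{(\tau,d)\in\mathcal{C}_{\alpha,\beta}(\mathcal{P})}\mathsf{E}^{\mathcal{A}}[\tau^q].$$
   Context: $\mathbb{N}=\{1,2,\dots\}$; $x\sim y$ means that the ratio $x/y$ tends to $1$ in the indicated limit. There are $K$ channels; in channel $k$ one observes a discrete-time stochastic process $X^k=\{X_t^k\}_{t\in\mathbb{N}}$. For each $k$, $\mathsf{P}_0^k$ ("noise only") and $\mathsf{P}_1^k$ ("signal and noise") are distinct probability measures on the canonical space of $X^k$ that are mutually absolutely continuous when restricted to $\mathscr{F}_t^k=\sigma(X_s^k;1\le s\le t)$, for every $t\in\mathbb{N}$. The local likelihood ratio and log-likelihood ratio are $\Lambda_t^k=\frac{d\mathsf{P}_1^k}{d\mathsf{P}_0^k}\big|_{\mathscr{F}_t^k}$ and $Z_t^k=\log\Lambda_t^k$. Channels are independent: $\mathsf{P}_0=\mathsf{P}_0^1\times\cdots\times\mathsf{P}_0^K$ is the law of $(X^1,\dots,X^K)$ under the global null $\mathsf{H}_0$, and for $\mathcal{A}\subset\{1,\dots,K\}$, $\mathsf{P}^{\mathcal{A}}$ is the product measure whose $k$-th factor is $\mathsf{P}_1^k$ if $k\in\mathcal{A}$ and $\mathsf{P}_0^k$ if $k\notin\mathcal{A}$. $\mathsf{E}_0,\mathsf{E}^{\mathcal{A}}$ are the corresponding expectations. $\mathscr{F}_t=\sigma(X_s^k;1\le s\le t,1\le k\le K)$, and $Z_t^{\mathcal{A}}=\log\frac{d\mathsf{P}^{\mathcal{A}}}{d\mathsf{P}_0}\big|_{\mathscr{F}_t}=\sum_{k\in\mathcal{A}}Z_t^k$.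 A sequential test is a pair $(\tau,d)$ where $\tau$ is an $\{\mathscr{F}_t\}$-stopping time (possibly infinite) and $d\in\{0,1\}$ is an $\mathscr{F}_\tau$-measurable decision with $\{d=i\}=\{\tau<\infty,\ \mathsf{H}_i\text{ is selected}\}$, $i=0,1$. For $\alpha,\beta\in(0,1)$, $$\mathcal{C}_{\alpha,\beta}(\mathcal{P})=\Big\{(\tau,d):\ \mathsf{P}_0(d=1)\le\alpha\ \text{ and }\ \max_{\mathcal{A}\in\mathcal{P}}\mathsf{P}^{\mathcal{A}}(d=0)\le\beta\Big\}.$$ The Generalized Sequential Likelihood Ratio Test (G-SLRT) with thresholds $a,b>0$ is $$\hat Z_t=\max_{\mathcal{A}\in\mathcal{P}}Z_t^{\mathcal{A}},\qquad \hat\tau=\inf\{t\in\mathbb{N}:\hat Z_t\notin(-a,b)\},$$ with $\hat d=1$ when $\hat Z_{\hat\tau}\ge b$ and $\hat d=0$ when $\hat Z_{\hat\tau}\le-a$. $|\mathcal{P}|$ is the cardinality of $\mathcal{P}$. *)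

theory Defs
  imports "HOL-Probability.Probability"
begin

section \<open>Observations and filtrations\<close>

text \<open>Discrete time is \<open>{1, 2, \<dots>}\<close>. The state space of a channel is an arbitrary measurable
  space \<open>S\<close>, and its canonical space is the space of sequences over \<open>S\<close>.\<close>

definition path_space :: "'a measure \<Rightarrow> (nat \<Rightarrow> 'a) measure" where
  "path_space S = PiM {1..} (\<lambda>_. S)"

definition sigma_vars ::
  "'w set \<Rightarrow> 'i set \<Rightarrow> ('i \<Rightarrow> 'a measure) \<Rightarrow> ('i \<Rightarrow> 'w \<Rightarrow> 'a) \<Rightarrow> 'w measure" where
  "sigma_vars \<Omega> J S X = sigma \<Omega> (\<Union>j\<in>J. {X j -` B \<inter> \<Omega> | B. B \<in> sets (S j)})"

definition local_filtration :: "'a measure \<Rightarrow> nat \<Rightarrow> (nat \<Rightarrow> 'a) measure" where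
  "local_filtration S t =
     sigma_vars (space (path_space S)) {1..t} (\<lambda>_. S) (\<lambda>s x. x s)"

text \<open>In the product of the \<open>K\<close> canonical spaces, \<open>\<omega> k s\<close> is the observation in channel \<open>k\<close> at
  time \<open>s\<close>. The filtration is indexed by extended naturals so that possibly infinite stopping
  times fit the library notions; at \<open>\<infinity>\<close> it is generated by all observations.\<close>

definition global_filtration ::
  "nat \<Rightarrow> (nat \<Rightarrow> 'a measure) \<Rightarrow> enat \<Rightarrow> (nat \<Rightarrow> nat \<Rightarrow> 'a) measure" where
  "global_filtration K S t =
     sigma_vars (PiE {1..K} (\<lambda>k. space (path_space (S k))))
       ({1..K} \<times> {s. 1 \<le> s \<and> enat s \<le> t}) (\<lambda>(k, s). S k) (\<lambda>(k, s) \<omega>. \<omega> k s)"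

text \<open>The law of all channels when \<open>A\<close> is the set of channels with signal; the global null law
  is the case \<open>A = {}\<close>.\<close>

definition joint_law ::
  "nat \<Rightarrow> (nat \<Rightarrow> (nat \<Rightarrow> 'a) measure) \<Rightarrow> (nat \<Rightarrow> (nat \<Rightarrow> 'a) measure) \<Rightarrow> nat set \<Rightarrow>
   (nat \<Rightarrow> nat \<Rightarrow> 'a) measure" where
  "joint_law K P0 P1 A = PiM {1..K} (\<lambda>k. if k \<in> A then P1 k else P0 k)"


section \<open>Log-likelihood ratios\<close>

text \<open>The logarithm of \<open>dQ/dP\<close> restricted to the sub-\<open>\<sigma>\<close>-algebra \<open>F\<close>, for the \<open>F\<close>-measurable
  version of the density chosen by \<^const>\<open>RN_deriv\<close>. The junk value \<open>0\<close>, where the density is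
  \<open>0\<close> or \<open>\<infinity>\<close>, only occurs on a null set when the restrictions are mutually absolutely
  continuous.\<close>

definition llr :: "'w measure \<Rightarrow> 'w measure \<Rightarrow> 'w measure \<Rightarrow> 'w \<Rightarrow> real" where
  "llr P Q F \<omega> =
     ln (enn2real (RN_deriv (restr_to_subalg P F) (restr_to_subalg Q F) \<omega>))"

definition local_llr ::
  "'a measure \<Rightarrow> (nat \<Rightarrow> 'a) measure \<Rightarrow> (nat \<Rightarrow> 'a) measure \<Rightarrow> nat \<Rightarrow> (nat \<Rightarrow> 'a) \<Rightarrow> real" where
  "local_llr S P Q t = llr P Q (local_filtration S t)"

definition llr_increment ::
  "'a measure \<Rightarrow> (nat \<Rightarrow> 'a) measure \<Rightarrow> (nat \<Rightarrow> 'a) measure \<Rightarrow> nat \<Rightarrow> (nat \<Rightarrow> 'a) \<Rightarrow> real" where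
  "llr_increment S P Q t x =
     local_llr S P Q t x - (if t = 1 then 0 else local_llr S P Q (t - 1) x)"

definition global_llr ::
  "nat \<Rightarrow> (nat \<Rightarrow> 'a measure) \<Rightarrow> (nat \<Rightarrow> (nat \<Rightarrow> 'a) measure) \<Rightarrow> (nat \<Rightarrow> (nat \<Rightarrow> 'a) measure) \<Rightarrow>
   nat set \<Rightarrow> nat \<Rightarrow> (nat \<Rightarrow> nat \<Rightarrow> 'a) \<Rightarrow> real" where
  "global_llr K S P0 P1 A t =
     llr (joint_law K P0 P1 {}) (joint_law K P0 P1 A) (global_filtration K S (enat t))"


section \<open>Sequential tests\<close>

text \<open>A decision \<open>Some i\<close> means that the test has stopped and selected \<open>H\<^sub>i\<close>; \<open>None\<close> is taken exactly
  when the test never stops.\<close>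

definition sequential_test ::
  "nat \<Rightarrow> (nat \<Rightarrow> 'a measure) \<Rightarrow>
   ((nat \<Rightarrow> nat \<Rightarrow> 'a) \<Rightarrow> enat) \<times> ((nat \<Rightarrow> nat \<Rightarrow> 'a) \<Rightarrow> nat option) \<Rightarrow> bool" where
  "sequential_test K S = (\<lambda>(\<tau>, d).
     let F = global_filtration K S; \<Omega> = space (F \<infinity>) in
       stopping_time F \<tau> \<and> (\<forall>\<omega>\<in>\<Omega>. 1 \<le> \<tau> \<omega>) \<and>
       d \<in> measurable (filtration.pre_sigma \<Omega> F \<tau>) (count_space UNIV) \<and>
       (\<forall>\<omega>\<in>\<Omega>. if \<tau> \<omega> < \<infinity> then d \<omega> \<in> {Some 0, Some 1} else d \<omega> = None))"

definition error_class ::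
  "nat \<Rightarrow> (nat \<Rightarrow> 'a measure) \<Rightarrow> (nat \<Rightarrow> (nat \<Rightarrow> 'a) measure) \<Rightarrow> (nat \<Rightarrow> (nat \<Rightarrow> 'a) measure) \<Rightarrow>
   nat set set \<Rightarrow> real \<Rightarrow> real \<Rightarrow>
   (((nat \<Rightarrow> nat \<Rightarrow> 'a) \<Rightarrow> enat) \<times> ((nat \<Rightarrow> nat \<Rightarrow> 'a) \<Rightarrow> nat option)) set" where
  "error_class K S P0 P1 \<A> \<alpha> \<beta> = {(\<tau>, d). sequential_test K S (\<tau>, d) \<and>
     \<P>(\<omega> in joint_law K P0 P1 {}. d \<omega> = Some 1) \<le> \<alpha> \<and>
     (MAX A\<in>\<A>. \<P>(\<omega> in joint_law K P0 P1 A. d \<omega> = Some 0)) \<le> \<beta>}"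

definition max_llr ::
  "nat \<Rightarrow> (nat \<Rightarrow> 'a measure) \<Rightarrow> (nat \<Rightarrow> (nat \<Rightarrow> 'a) measure) \<Rightarrow> (nat \<Rightarrow> (nat \<Rightarrow> 'a) measure) \<Rightarrow>
   nat set set \<Rightarrow> nat \<Rightarrow> (nat \<Rightarrow> nat \<Rightarrow> 'a) \<Rightarrow> real" where
  "max_llr K S P0 P1 \<A> t \<omega> = (MAX A\<in>\<A>. global_llr K S P0 P1 A t \<omega>)"

text \<open>The infimum of the empty set of extended naturals is \<open>\<infinity>\<close>.\<close>

definition gslrt_time ::
  "nat \<Rightarrow> (nat \<Rightarrow> 'a measure) \<Rightarrow> (nat \<Rightarrow> (nat \<Rightarrow> 'a) measure) \<Rightarrow> (nat \<Rightarrow> (nat \<Rightarrow> 'a) measure) \<Rightarrow>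
   nat set set \<Rightarrow> real \<Rightarrow> real \<Rightarrow> (nat \<Rightarrow> nat \<Rightarrow> 'a) \<Rightarrow> enat" where
  "gslrt_time K S P0 P1 \<A> a b \<omega> =
     Inf (enat ` {t. 1 \<le> t \<and> max_llr K S P0 P1 \<A> t \<omega> \<notin> {-a<..<b}})"

definition gslrt_decision ::
  "nat \<Rightarrow> (nat \<Rightarrow> 'a measure) \<Rightarrow> (nat \<Rightarrow> (nat \<Rightarrow> 'a) measure) \<Rightarrow> (nat \<Rightarrow> (nat \<Rightarrow> 'a) measure) \<Rightarrow>
   nat set set \<Rightarrow> real \<Rightarrow> real \<Rightarrow> (nat \<Rightarrow> nat \<Rightarrow> 'a) \<Rightarrow> nat option" where
  "gslrt_decision K S P0 P1 \<A> a b \<omega> =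
     (case gslrt_time K S P0 P1 \<A> a b \<omega> of
        \<infinity> \<Rightarrow> None
      | enat t \<Rightarrow> if b \<le> max_llr K S P0 P1 \<A> t \<omega> then Some 1 else Some 0)"

definition gslrt ::
  "nat \<Rightarrow> (nat \<Rightarrow> 'a measure) \<Rightarrow> (nat \<Rightarrow> (nat \<Rightarrow> 'a) measure) \<Rightarrow> (nat \<Rightarrow> (nat \<Rightarrow> 'a) measure) \<Rightarrow>
   nat set set \<Rightarrow> real \<Rightarrow> real \<Rightarrow>
   ((nat \<Rightarrow> nat \<Rightarrow> 'a) \<Rightarrow> enat) \<times> ((nat \<Rightarrow> nat \<Rightarrow> 'a) \<Rightarrow> nat option)" where
  "gslrt K S P0 P1 \<A> a b = (gslrt_time K S P0 P1 \<A> a b, gslrt_decision K S P0 P1 \<A> a b)"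

definition time_moment :: "'w measure \<Rightarrow> nat \<Rightarrow> ('w \<Rightarrow> enat) \<Rightarrow> ennreal" where
  "time_moment M q \<tau> = (\<integral>\<^sup>+\<omega>. ennreal_of_enat (\<tau> \<omega>) ^ q \<partial>M)"


section \<open>Asymptotics\<close>

text \<open>Moments may a priori be infinite, so asymptotic equivalence is taken in \<^typ>\<open>ennreal\<close>. There
  \<open>\<infinity> / \<infinity> = 0 / 0 = 0\<close>, so the ratio can tend to \<open>1\<close> only if both sides are eventually
  positive and finite.\<close>

definition ratio_equiv :: "'p filter \<Rightarrow> ('p \<Rightarrow> ennreal) \<Rightarrow> ('p \<Rightarrow> ennreal) \<Rightarrow> bool" where
  "ratio_equiv F f g \<longleftrightarrow> ((\<lambda>p. f p / g p) \<longlongrightarrow> 1) F"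

text \<open>The limit \<open>max(\<alpha>, \<beta>) \<rightarrow> 0\<close> over pairs \<open>(\<alpha>, \<beta>)\<close> in \<open>(0,1)\<^sup>2\<close>.\<close>

definition max_to_zero :: "(real \<times> real) filter" where
  "max_to_zero =
     inf (filtercomap (\<lambda>(\<alpha>, \<beta>). max \<alpha> \<beta>) (nhds 0)) (principal ({0<..<1} \<times> {0<..<1}))"

end

theory Submission
  imports Defs
begin

text \<open>Write \<open>Z\<close> for the log-likelihood ratios. Everything rests on the identity
\<open>P\<^sup>A(E) = E\<^sub>0[exp Z\<^sup>A\<^sub>t; E]\<close> for events \<open>E\<close> up to time \<open>t\<close>, together with \<open>Z\<^sup>A\<^sub>t = \<Sum>k\<in>A. Z\<^sup>k\<^sub>t\<close> almost
surely (lemmas \<open>density_global_llr\<close> and \<open>global_llr_eq_sum\<close>).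

The lower bounds use the identity at one deterministic time. If a test rejects the null with
\<open>P\<^sub>0\<close>-probability at most \<open>\<alpha>\<close> and accepts it with \<open>P\<^sup>A\<close>-probability at most \<open>\<beta>\<close>, then, splitting at \<open>- Z\<^sup>A\<^sub>n > x\<close>,
\<open>P\<^sub>0(\<tau> \<le> n) \<le> \<alpha> + exp x * \<beta> + P\<^sub>0(- Z\<^sup>A\<^sub>n > x)\<close> (\<open>early_stopping_bound\<close>). With \<open>n = r |log \<beta>| / I\<close> and
\<open>x = s |log \<beta>|\<close> for \<open>r < s < 1\<close> the right-hand side vanishes by the law of large numbers, uniformly over
all tests in the class (\<open>moment_lower\<close>). The same argument with the two laws exchanged gives the bound
under \<open>P\<^sup>A\<close>.

For the upper bounds, the G-SLRT stops no later than the first time at which all \<open>- Z\<^sup>A\<close> are at least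
\<open>a\<close> (under the null), or at which \<open>Z\<^sup>A\<close> has reached \<open>b\<close> (under \<open>P\<^sup>A\<close>). The law of large numbers
identifies the limit of this first passage time in probability. Convergence of moments needs more,
because almost sure convergence carries no rate; this is where independence of the increments enters.
Let \<open>h(t)\<close> be the probability that the level \<open>b\<close> has not been passed by time \<open>t\<close>. If it has not been passed
by time \<open>2t\<close>, then either some increment over \<open>(t, 2t]\<close> is smaller than \<open>c t\<close>, which is independent of the past
and has a probability \<open>\<epsilon>(t) \<rightarrow> 0\<close>, or some process is already below \<open>b - c t\<close> at time \<open>t\<close>, which has
probability at most \<open>exp (- (c t - b))\<close> by the change of measure. Hence
\<open>h(2t) \<le> \<epsilon>(t) h(t) + const * exp (- (c t - b))\<close> (\<open>prob_below_double\<close>). Starting slightly beyond \<open>b / J\<close>, with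
\<open>J\<close> the least limiting speed, \<open>h\<close> decays along dyadic times faster than any prescribed power of time
(\<open>prob_below_geometric\<close>), so that the tail contributes a negligible part of the moment
(\<open>moment_upper\<close>).

Finally the G-SLRT with the stated thresholds belongs to the class (\<open>gslrt_in_error_class\<close>), so the
infimum is squeezed between the lower bound and the moment of the G-SLRT.\<close>

section \<open>Log-likelihood ratios and change of measure\<close>

lemma measurable_llr:
  assumes "subalgebra P F"
  shows "llr P Q F \<in> borel_measurable F"
proof -
  have "RN_deriv (restr_to_subalg P F) (restr_to_subalg Q F) \<in> borel_measurable F"
    using borel_measurable_RN_deriv measurable_cong_sets[OF sets_restr_to_subalg[OF assms] refl] by blast
  then show ?thesis
    unfolding llr_def[abs_def] by measurable
qed

text \<open>Mutual absolute continuity makes the density positive and finite almost everywhere, so taking its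
logarithm and exponential again loses nothing.\<close>

lemma density_exp_llr:
  assumes "prob_space P" "prob_space Q" "subalgebra P F" "subalgebra Q F"
    and ac: "absolutely_continuous (restr_to_subalg P F) (restr_to_subalg Q F)"
      "absolutely_continuous (restr_to_subalg Q F) (restr_to_subalg P F)"
  shows "restr_to_subalg Q F = density (restr_to_subalg P F) (\<lambda>\<omega>. ennreal (exp (llr P Q F \<omega>)))"
proof -
  interpret p: prob_space "restr_to_subalg P F" using assms prob_space_restr_to_subalg by blast
  interpret q: prob_space "restr_to_subalg Q F" using assms prob_space_restr_to_subalg by blast
  let ?R = "RN_deriv (restr_to_subalg P F) (restr_to_subalg Q F)"
  have sets: "sets (restr_to_subalg Q F) = sets (restr_to_subalg P F)"
    using assms by (simp add: sets_restr_to_subalg)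
  obtain D where D: "D \<in> borel_measurable (restr_to_subalg P F)"
      "AE x in restr_to_subalg P F. ?R x = ennreal (D x)"
      "AE x in restr_to_subalg Q F. 0 < D x"
    using p.real_RN_deriv[OF q.finite_measure_axioms ac(1) sets] by metis
  have "AE x in restr_to_subalg P F. 0 < D x"
    using absolutely_continuous_AE[OF sets[symmetric] ac(2) D(3)] .
  with D(2) have "AE x in restr_to_subalg P F. ?R x = ennreal (exp (llr P Q F x))"
    by eventually_elim (simp add: llr_def)
  moreover have "(\<lambda>x. ennreal (exp (llr P Q F x))) \<in> borel_measurable (restr_to_subalg P F)"
    using measurable_in_subalg[OF assms(3) measurable_llr[OF assms(3), of Q]] by measurable
  ultimately have "density (restr_to_subalg P F) ?R
      = density (restr_to_subalg P F) (\<lambda>\<omega>. ennreal (exp (llr P Q F \<omega>)))"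
    by (intro density_cong) auto
  then show ?thesis
    using p.density_RN_deriv[OF ac(1) sets] by simp
qed

lemma llr_eqI:
  assumes "prob_space P" "subalgebra P F" and [measurable]: "g \<in> borel_measurable F"
    and dens: "restr_to_subalg Q F = density (restr_to_subalg P F) (\<lambda>\<omega>. ennreal (exp (g \<omega>)))"
  shows "AE \<omega> in restr_to_subalg P F. llr P Q F \<omega> = g \<omega>"
proof -
  interpret p: prob_space "restr_to_subalg P F" using assms prob_space_restr_to_subalg by blast
  have [measurable]: "g \<in> borel_measurable (restr_to_subalg P F)"
    by (rule measurable_in_subalg[OF assms(2)]) measurable
  have "AE \<omega> in restr_to_subalg P F. ennreal (exp (g \<omega>)) = RN_deriv (restr_to_subalg P F) (restr_to_subalg Q F) \<omega>"
    by (rule p.RN_deriv_unique) (use dens in auto)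
  then show ?thesis
    unfolding llr_def by eventually_elim (metis enn2real_ennreal exp_ge_zero ln_exp)
qed

text \<open>One-sided changes of measure: both follow by integrating the density over \<open>E\<close>, where it is at most
\<open>exp x\<close>, respectively at least \<open>exp (- x)\<close>.\<close>

lemma measure_le_exp:
  assumes "prob_space P" "prob_space Q" "subalgebra P F" "subalgebra Q F"
    and [measurable]: "L \<in> borel_measurable F"
    and dens: "restr_to_subalg Q F = density (restr_to_subalg P F) (\<lambda>\<omega>. ennreal (exp (L \<omega>)))"
    and E: "E \<in> sets F"
  shows measure_le_exp_if_le: "(\<And>\<omega>. \<omega> \<in> E \<Longrightarrow> L \<omega> \<le> x) \<Longrightarrow> measure Q E \<le> exp x * measure P E"
    and measure_le_exp_if_ge: "(\<And>\<omega>. \<omega> \<in> E \<Longrightarrow> - x \<le> L \<omega>) \<Longrightarrow> measure P E \<le> exp x * measure Q E"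
proof -
  interpret p: prob_space P by fact
  interpret q: prob_space Q by fact
  have EP: "E \<in> sets (restr_to_subalg P F)" using E assms(3) by (simp add: sets_restr_to_subalg)
  have [measurable]: "L \<in> borel_measurable (restr_to_subalg P F)"
    by (rule measurable_in_subalg[OF assms(3)]) measurable
  have Q: "emeasure Q E = (\<integral>\<^sup>+\<omega>. ennreal (exp (L \<omega>)) * indicator E \<omega> \<partial>restr_to_subalg P F)"
    using emeasure_restr_to_subalg[OF assms(4) E] dens EP by (simp add: emeasure_density)
  have P: "ennreal c * emeasure P E = (\<integral>\<^sup>+\<omega>. ennreal c * indicator E \<omega> \<partial>restr_to_subalg P F)" for c
    using EP emeasure_restr_to_subalg[OF assms(3) E] by (simp add: nn_integral_cmult)
  show "measure Q E \<le> exp x * measure P E" if "\<And>\<omega>. \<omega> \<in> E \<Longrightarrow> L \<omega> \<le> x"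
  proof -
    have "emeasure Q E \<le> ennreal (exp x) * emeasure P E"
      unfolding Q P using that by (intro nn_integral_mono) (auto simp: indicator_def)
    then show ?thesis
      by (simp add: p.emeasure_eq_measure q.emeasure_eq_measure flip: ennreal_mult)
  qed
  show "measure P E \<le> exp x * measure Q E" if "\<And>\<omega>. \<omega> \<in> E \<Longrightarrow> - x \<le> L \<omega>"
  proof -
    have "ennreal (exp (- x)) * emeasure P E \<le> emeasure Q E"
      unfolding Q P using that by (intro nn_integral_mono) (auto simp: indicator_def)
    then have "exp (- x) * measure P E \<le> measure Q E"
      by (simp add: p.emeasure_eq_measure q.emeasure_eq_measure flip: ennreal_mult)
    then have "exp x * (exp (- x) * measure P E) \<le> exp x * measure Q E"
      by (rule mult_left_mono) simp
    then show ?thesis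
      by (simp add: exp_minus field_simps)
  qed
qed

section \<open>Densities and restrictions of finite products\<close>

lemma emeasure_PiM_PiE:
  assumes "finite I" and M: "\<And>i. i \<in> I \<Longrightarrow> prob_space (M i)"
    and A: "\<And>i. i \<in> I \<Longrightarrow> A i \<in> sets (M i)"
  shows "emeasure (PiM I M) (PiE I A) = (\<Prod>i\<in>I. emeasure (M i) (A i))"
proof -
  have "prod_emb I M I (PiE I A) = PiE I A"
    by (rule prod_emb_PiE_same_index) (use A sets.sets_into_space in auto)
  then show ?thesis
    using emeasure_PiM_emb[of I M I A] M A \<open>finite I\<close> by simp
qed

text \<open>Rectangles determine a finite product measure. Nothing is known about \<open>M\<close> outside \<open>I\<close>, so the family is
padded with point masses there.\<close>

lemma measure_eq_PiM:
  assumes "finite I" and M: "\<And>i. i \<in> I \<Longrightarrow> prob_space (M i)"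
    and sets: "sets P = sets (PiM I M)"
    and eq: "\<And>A. (\<And>i. i \<in> I \<Longrightarrow> A i \<in> sets (M i)) \<Longrightarrow>
      emeasure P (PiE I A) = (\<Prod>i\<in>I. emeasure (M i) (A i))"
  shows "P = PiM I M"
proof -
  define M' where "M' i = (if i \<in> I then M i else count_space {undefined})" for i
  have "prob_space (count_space {undefined :: 'b})" by (rule prob_spaceI) simp
  then interpret product_prob_space M'
    by (intro product_prob_spaceI) (use M in \<open>auto simp: M'_def\<close>)
  have PM: "PiM I M = PiM I M'" by (auto intro!: PiM_cong simp: M'_def)
  have "P = PiM I M'"
  proof (rule PiM_eqI[OF \<open>finite I\<close>])
    show "sets P = sets (PiM I M')" using sets by (simp add: PM)
    fix A assume A: "\<And>i. i \<in> I \<Longrightarrow> A i \<in> sets (M' i)"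
    have "A i \<in> sets (M i)" if "i \<in> I" for i using A[OF that] that by (simp add: M'_def)
    from eq[OF this] show "emeasure P (PiE I A) = (\<Prod>i\<in>I. emeasure (M' i) (A i))"
      by (simp add: M'_def)
  qed
  then show ?thesis by (simp add: PM)
qed

lemma PiM_density:
  assumes "finite I" and M: "\<And>i. i \<in> I \<Longrightarrow> prob_space (M i)" and N: "\<And>i. i \<in> I \<Longrightarrow> prob_space (N i)"
    and f: "\<And>i. i \<in> I \<Longrightarrow> f i \<in> borel_measurable (M i)"
    and N_eq: "\<And>i. i \<in> I \<Longrightarrow> N i = density (M i) (f i)"
  shows "PiM I N = density (PiM I M) (\<lambda>x. \<Prod>i\<in>I. f i (x i))"
proof -
  define M' where "M' i = (if i \<in> I then M i else count_space {undefined})" for i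
  have "prob_space (count_space {undefined :: 'b})" by (rule prob_spaceI) simp
  then interpret m: product_prob_space M'
    by (intro product_prob_spaceI) (use M in \<open>auto simp: M'_def\<close>)
  have [simp]: "sets (N i) = sets (M i)" if "i \<in> I" for i using N_eq[OF that] by simp
  have PM: "PiM I M = PiM I M'" by (auto intro!: PiM_cong simp: M'_def)
  have setseq: "sets (PiM I M') = sets (PiM I N)"
    by (rule sets_PiM_cong) (auto simp: M'_def)
  have [measurable]: "(\<lambda>x. f i (x i)) \<in> borel_measurable (PiM I M')" if "i \<in> I" for i
    using f[OF that] that by (intro measurable_compose[OF measurable_component_singleton]) (auto simp: M'_def)
  have "density (PiM I M') (\<lambda>x. \<Prod>i\<in>I. f i (x i)) = PiM I N"
  proof (rule measure_eq_PiM[OF \<open>finite I\<close> N])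
    show "sets (density (PiM I M') (\<lambda>x. \<Prod>i\<in>I. f i (x i))) = sets (PiM I N)"
      using setseq by simp
    fix A assume A: "\<And>i. i \<in> I \<Longrightarrow> A i \<in> sets (N i)"
    have A': "A i \<in> sets (M i)" if "i \<in> I" for i using A[OF that] that by simp
    have PA: "PiE I A \<in> sets (PiM I M')"
      using A' \<open>finite I\<close> by (intro sets_PiM_I_finite) (auto simp: M'_def)
    have "emeasure (density (PiM I M') (\<lambda>x. \<Prod>i\<in>I. f i (x i))) (PiE I A)
        = (\<integral>\<^sup>+x. (\<Prod>i\<in>I. f i (x i)) * indicator (PiE I A) x \<partial>PiM I M')"
      by (rule emeasure_density[OF _ PA]) measurable
    also have "\<dots> = (\<integral>\<^sup>+x. (\<Prod>i\<in>I. f i (x i) * indicator (A i) (x i)) \<partial>PiM I M')"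
    proof (rule nn_integral_cong)
      fix x assume "x \<in> space (PiM I M')"
      then have "x \<in> extensional I" by (auto simp: space_PiM PiE_def)
      then have "indicator (PiE I A) x = (\<Prod>i\<in>I. indicator (A i) (x i) :: ennreal)"
        using \<open>finite I\<close> by (auto simp: indicator_def PiE_def Pi_def prod_eq_1_iff)
      then show "(\<Prod>i\<in>I. f i (x i)) * indicator (PiE I A) x = (\<Prod>i\<in>I. f i (x i) * indicator (A i) (x i))"
        by (simp add: prod.distrib)
    qed
    also have "\<dots> = (\<Prod>i\<in>I. \<integral>\<^sup>+x. f i x * indicator (A i) x \<partial>M' i)"
      using f A' by (intro m.product_nn_integral_prod \<open>finite I\<close>) (auto simp: M'_def)
    also have "\<dots> = (\<Prod>i\<in>I. emeasure (N i) (A i))"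
      by (intro prod.cong refl) (use f A' in \<open>auto simp: M'_def N_eq emeasure_density\<close>)
    finally show "emeasure (density (PiM I M') (\<lambda>x. \<Prod>i\<in>I. f i (x i))) (PiE I A) = (\<Prod>i\<in>I. emeasure (N i) (A i))" .
  qed
  then show ?thesis by (simp add: PM)
qed

text \<open>This transports densities: restricting the law of all channels to the observations up to time \<open>t\<close> is
the same as taking the product of the restricted laws of the single channels.\<close>

lemma restr_to_subalg_PiM:
  assumes "finite I" and M: "\<And>i. i \<in> I \<Longrightarrow> prob_space (M i)"
    and F: "\<And>i. i \<in> I \<Longrightarrow> subalgebra (M i) (F i)"
    and G: "sets G = sets (PiM I F)"
  shows "subalgebra (PiM I M) G"
    and "restr_to_subalg (PiM I M) G = PiM I (\<lambda>i. restr_to_subalg (M i) (F i))"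
proof -
  have sp: "space (F i) = space (M i)" if "i \<in> I" for i using F[OF that] by (simp add: subalgebra_def)
  have "(\<lambda>x. x) \<in> measurable (PiM I M) (PiM I F)"
  proof (rule measurable_PiM_single')
    show "(\<lambda>x. x) \<in> space (PiM I M) \<rightarrow> (\<Pi>\<^sub>E i\<in>I. space (F i))"
      using sp by (auto simp: space_PiM PiE_def Pi_def)
    show "(\<lambda>x. x i) \<in> measurable (PiM I M) (F i)" if "i \<in> I" for i
      using F[OF that]
      by (intro measurable_compose[OF measurable_component_singleton[OF that]])
         (auto simp: measurable_def subalgebra_def intro!: sets.Int)
  qed
  moreover have spG: "space G = space (PiM I M)"
    using sets_eq_imp_space_eq[OF G] sp by (auto simp: space_PiM intro!: PiE_cong)
  moreover have "space (PiM I F) = space (PiM I M)"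
    using sets_eq_imp_space_eq[OF G] spG by simp
  ultimately show sub: "subalgebra (PiM I M) G"
    unfolding subalgebra_def G by (auto dest: measurable_sets simp: sets.Int_space_eq2 dest!: measurable_sets)
       (metis inf.absorb1 sets.sets_into_space vimage_ident measurable_sets)
  show "restr_to_subalg (PiM I M) G = PiM I (\<lambda>i. restr_to_subalg (M i) (F i))"
  proof (rule measure_eq_PiM[OF \<open>finite I\<close>])
    show "prob_space (restr_to_subalg (M i) (F i))" if "i \<in> I" for i
      using M F that by (intro prob_space_restr_to_subalg)
    have "sets (PiM I F) = sets (PiM I (\<lambda>i. restr_to_subalg (M i) (F i)))"
      by (rule sets_PiM_cong) (auto simp: F sets_restr_to_subalg)
    then show "sets (restr_to_subalg (PiM I M) G) = sets (PiM I (\<lambda>i. restr_to_subalg (M i) (F i)))"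
      using sub G by (simp add: sets_restr_to_subalg)
    fix A assume A: "\<And>i. i \<in> I \<Longrightarrow> A i \<in> sets (restr_to_subalg (M i) (F i))"
    have A': "A i \<in> sets (F i)" if "i \<in> I" for i
      using A[OF that] that by (simp add: sets_restr_to_subalg F)
    have A'': "A i \<in> sets (M i)" if "i \<in> I" for i
      using A'[OF that] F[OF that] by (auto simp: subalgebra_def)
    have "PiE I A \<in> sets G" unfolding G using A' \<open>finite I\<close> by (intro sets_PiM_I_finite) auto
    then have "emeasure (restr_to_subalg (PiM I M) G) (PiE I A) = emeasure (PiM I M) (PiE I A)"
      using sub by (simp add: emeasure_restr_to_subalg)
    also have "\<dots> = (\<Prod>i\<in>I. emeasure (M i) (A i))"
      by (rule emeasure_PiM_PiE[OF \<open>finite I\<close> M A''])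
    also have "\<dots> = (\<Prod>i\<in>I. emeasure (restr_to_subalg (M i) (F i)) (A i))"
      by (intro prod.cong refl) (use A' F in \<open>auto simp: emeasure_restr_to_subalg\<close>)
    finally show "emeasure (restr_to_subalg (PiM I M) G) (PiE I A)
        = (\<Prod>i\<in>I. emeasure (restr_to_subalg (M i) (F i)) (A i))" .
  qed
qed

section \<open>The filtrations\<close>

lemma space_sigma_vars [simp]: "space (sigma_vars \<Omega> J S X) = \<Omega>"
  unfolding sigma_vars_def by (rule space_measure_of) auto

lemma sets_sigma_vars:
  "sets (sigma_vars \<Omega> J S X) = sigma_sets \<Omega> (\<Union>j\<in>J. {X j -` B \<inter> \<Omega> | B. B \<in> sets (S j)})"
  unfolding sigma_vars_def by (rule sets_measure_of) auto

lemma measurable_sigma_vars: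
  assumes "j \<in> J" "X j \<in> \<Omega> \<rightarrow> space (S j)"
  shows "X j \<in> measurable (sigma_vars \<Omega> J S X) (S j)"
  using assms by (intro measurableI) (auto simp: sets_sigma_vars intro!: sigma_sets.Basic)

lemma sets_sigma_vars_le:
  assumes "space M = \<Omega>" "\<And>j. j \<in> J \<Longrightarrow> X j \<in> measurable M (S j)"
  shows "sets (sigma_vars \<Omega> J S X) \<subseteq> sets M"
  unfolding sets_sigma_vars assms(1)[symmetric]
  by (rule sets.sigma_sets_subset) (auto intro: measurable_sets assms(2))

text \<open>Both sides are generated by the observations \<open>\<omega> k s\<close> with \<open>s \<le> t\<close>.\<close>

lemma sets_global_filtration:
  "sets (global_filtration K S (enat t)) = sets (PiM {1..K} (\<lambda>k. local_filtration (S k) t))"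
proof
  let ?L = "\<lambda>k. local_filtration (S k) t"
  have sp: "space (PiM {1..K} ?L) = (\<Pi>\<^sub>E k\<in>{1..K}. space (path_space (S k)))"
    by (simp add: space_PiM local_filtration_def)
  have coord: "(\<lambda>x. x s) \<in> measurable (?L k) (S k)" if "s \<in> {1..t}" for k s
    unfolding local_filtration_def using that
    by (intro measurable_sigma_vars[of s _ "\<lambda>s x. x s" _ "\<lambda>_. S k"]) (auto simp: path_space_def space_PiM PiE_def)
  show "sets (global_filtration K S (enat t)) \<subseteq> sets (PiM {1..K} ?L)"
    unfolding global_filtration_def
  proof (rule sets_sigma_vars_le[OF sp])
    fix j assume "j \<in> {1..K} \<times> {s. 1 \<le> s \<and> enat s \<le> enat t}"
    then obtain k s where j: "j = (k, s)" "k \<in> {1..K}" "s \<in> {1..t}" by auto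
    have "(\<lambda>\<omega>. \<omega> k s) \<in> measurable (PiM {1..K} ?L) (S k)"
      by (rule measurable_compose[OF measurable_component_singleton[OF j(2)] coord[OF j(3)]])
    then show "(case j of (k, s) \<Rightarrow> \<lambda>\<omega>. \<omega> k s) \<in> measurable (PiM {1..K} ?L) (case j of (k, s) \<Rightarrow> S k)"
      by (simp add: j)
  qed
  have spG: "space (global_filtration K S (enat t)) = (\<Pi>\<^sub>E k\<in>{1..K}. space (path_space (S k)))"
    by (simp add: global_filtration_def)
  have "(\<lambda>\<omega>. \<omega>) \<in> measurable (global_filtration K S (enat t)) (PiM {1..K} ?L)"
  proof (rule measurable_PiM_single')
    show "(\<lambda>\<omega>. \<omega>) \<in> space (global_filtration K S (enat t)) \<rightarrow> (\<Pi>\<^sub>E k\<in>{1..K}. space (?L k))"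
      by (simp add: spG local_filtration_def)
    fix k assume k: "k \<in> {1..K}"
    have le: "{\<omega> \<in> space (global_filtration K S (enat t)). \<omega> k s \<in> B} \<in> sets (global_filtration K S (enat t))"
      if "s \<in> {1..t}" "B \<in> sets (S k)" for s B
    proof -
      have "(case (k, s) of (k, s) \<Rightarrow> \<lambda>\<omega>. \<omega> k s) \<in> measurable (global_filtration K S (enat t)) (case (k, s) of (k, s) \<Rightarrow> S k)"
        unfolding global_filtration_def using that k
        by (intro measurable_sigma_vars) (auto simp: path_space_def space_PiM PiE_def Pi_def extensional_def)
      then show ?thesis using that by (auto intro: measurable_sets_Collect)
    qed
    show "(\<lambda>\<omega>. \<omega> k) \<in> measurable (global_filtration K S (enat t)) (?L k)"
    proof (rule measurable_sigma_sets)
      show "sets (?L k) = sigma_sets (space (path_space (S k)))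
         (\<Union>s\<in>{1..t}. {(\<lambda>x. x s) -` B \<inter> space (path_space (S k)) | B. B \<in> sets (S k)})"
        unfolding local_filtration_def by (rule sets_sigma_vars)
      show "(\<Union>s\<in>{1..t}. {(\<lambda>x. x s) -` B \<inter> space (path_space (S k)) | B. B \<in> sets (S k)})
         \<subseteq> Pow (space (path_space (S k)))" by auto
      show "(\<lambda>\<omega>. \<omega> k) \<in> space (global_filtration K S (enat t)) \<rightarrow> space (path_space (S k))"
        using k by (auto simp: spG)
      fix Y assume "Y \<in> (\<Union>s\<in>{1..t}. {(\<lambda>x. x s) -` B \<inter> space (path_space (S k)) | B. B \<in> sets (S k)})"
      then obtain s B where sB: "s \<in> {1..t}" "B \<in> sets (S k)" "Y = (\<lambda>x. x s) -` B \<inter> space (path_space (S k))"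
        by auto
      have "(\<lambda>\<omega>. \<omega> k) -` Y \<inter> space (global_filtration K S (enat t))
          = {\<omega> \<in> space (global_filtration K S (enat t)). \<omega> k s \<in> B}"
        using k by (auto simp: sB spG)
      then show "(\<lambda>\<omega>. \<omega> k) -` Y \<inter> space (global_filtration K S (enat t)) \<in> sets (global_filtration K S (enat t))"
        using le[OF sB(1,2)] by simp
    qed
  qed
  note id = this
  show "sets (PiM {1..K} ?L) \<subseteq> sets (global_filtration K S (enat t))"
  proof
    fix E assume E: "E \<in> sets (PiM {1..K} ?L)"
    then have "(\<lambda>\<omega>. \<omega>) -` E \<inter> space (global_filtration K S (enat t)) = E"
      using sets.sets_into_space[OF E] unfolding sp spG by auto
    with measurable_sets[OF id E] show "E \<in> sets (global_filtration K S (enat t))" by simp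
  qed
qed

lemma filtration_global: "filtration (\<Pi>\<^sub>E k\<in>{1..K}. space (path_space (S k))) (global_filtration K S)"
proof
  show "space (global_filtration K S i) = (\<Pi>\<^sub>E k\<in>{1..K}. space (path_space (S k)))" for i
    by (simp add: global_filtration_def)
  show "sets (global_filtration K S i) \<subseteq> sets (global_filtration K S j)" if "i \<le> j" for i j
    unfolding global_filtration_def sets_sigma_vars
    by (intro sigma_sets_mono' UN_mono Sigma_mono subset_refl Collect_mono) (use that in \<open>auto intro: order_trans\<close>)
qed

section \<open>Likelihood ratios of independent channels\<close>

locale channels =
  fixes K :: nat
    and S :: "nat \<Rightarrow> 'a measure"
    and P0 P1 :: "nat \<Rightarrow> (nat \<Rightarrow> 'a) measure"
  assumes prob0: "\<And>k. k \<in> {1..K} \<Longrightarrow> prob_space (P0 k)"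
    and prob1: "\<And>k. k \<in> {1..K} \<Longrightarrow> prob_space (P1 k)"
    and sets0: "\<And>k. k \<in> {1..K} \<Longrightarrow> sets (P0 k) = sets (path_space (S k))"
    and sets1: "\<And>k. k \<in> {1..K} \<Longrightarrow> sets (P1 k) = sets (path_space (S k))"
    and ac01: "\<And>k t. k \<in> {1..K} \<Longrightarrow> 1 \<le> t \<Longrightarrow>
      absolutely_continuous (restr_to_subalg (P0 k) (local_filtration (S k) t))
                            (restr_to_subalg (P1 k) (local_filtration (S k) t))"
    and ac10: "\<And>k t. k \<in> {1..K} \<Longrightarrow> 1 \<le> t \<Longrightarrow>
      absolutely_continuous (restr_to_subalg (P1 k) (local_filtration (S k) t))
                            (restr_to_subalg (P0 k) (local_filtration (S k) t))"
begin

abbreviation law :: "nat set \<Rightarrow> (nat \<Rightarrow> nat \<Rightarrow> 'a) measure" where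
  "law A \<equiv> joint_law K P0 P1 A"

abbreviation chan :: "nat set \<Rightarrow> nat \<Rightarrow> (nat \<Rightarrow> 'a) measure" where
  "chan A k \<equiv> (if k \<in> A then P1 k else P0 k)"

abbreviation G :: "nat \<Rightarrow> (nat \<Rightarrow> nat \<Rightarrow> 'a) measure" where
  "G t \<equiv> global_filtration K S (enat t)"

text \<open>The log-likelihood ratio of channel \<open>k\<close>, regarded as a function of the observations in all channels.
The definition of \<^const>\<open>global_llr\<close> chooses a version of the joint density, so its increments are sums of
channel increments only almost surely; sums of the processes \<open>Z k\<close> have this property pointwise.\<close>

definition Z :: "nat \<Rightarrow> nat \<Rightarrow> (nat \<Rightarrow> nat \<Rightarrow> 'a) \<Rightarrow> real" where
  "Z k t \<omega> = local_llr (S k) (P0 k) (P1 k) t (\<omega> k)"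

lemma prob_chan: "k \<in> {1..K} \<Longrightarrow> prob_space (chan A k)"
  using prob0 prob1 by simp

lemma prob_law: "prob_space (law A)"
  unfolding joint_law_def by (rule prob_space_PiM) (use prob_chan in auto)

lemma subalgebra_chan:
  assumes "k \<in> {1..K}"
  shows "subalgebra (chan A k) (local_filtration (S k) t)"
proof -
  have s: "sets (chan A k) = sets (path_space (S k))" using assms sets0 sets1 by simp
  have sp: "space (chan A k) = space (path_space (S k))" by (rule sets_eq_imp_space_eq[OF s])
  have "sets (local_filtration (S k) t) \<subseteq> sets (path_space (S k))"
    unfolding local_filtration_def
    by (rule sets_sigma_vars_le) (auto simp: path_space_def)
  then show ?thesis
    unfolding subalgebra_def s sp by (simp add: local_filtration_def)
qed

lemma subalgebra_law: "subalgebra (law A) (G t)"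
  unfolding joint_law_def
  by (rule restr_to_subalg_PiM[where F = "\<lambda>k. local_filtration (S k) t"];
      (rule finite_atLeastAtMost sets_global_filtration | erule prob_chan subalgebra_chan))

lemma restr_law:
  "restr_to_subalg (law A) (G t) =
    PiM {1..K} (\<lambda>k. restr_to_subalg (chan A k) (local_filtration (S k) t))"
  unfolding joint_law_def
  by (rule restr_to_subalg_PiM;
      (rule finite_atLeastAtMost sets_global_filtration | erule prob_chan subalgebra_chan))

lemma measurable_local_llr:
  assumes "k \<in> {1..K}"
  shows "local_llr (S k) (P0 k) (P1 k) t \<in> borel_measurable (local_filtration (S k) t)"
  unfolding local_llr_def using measurable_llr[OF subalgebra_chan[OF assms, of "{}" t]] by simp

lemma measurable_Z [measurable]:
  assumes "k \<in> {1..K}"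
  shows "Z k t \<in> borel_measurable (G t)"
proof -
  have "Z k t \<in> borel_measurable (PiM {1..K} (\<lambda>k. local_filtration (S k) t))"
    unfolding Z_def[abs_def]
    using measurable_local_llr[OF assms] assms
    by (intro measurable_compose[OF measurable_component_singleton]) auto
  then show ?thesis
    using measurable_cong_sets[OF sets_global_filtration refl] by blast
qed

text \<open>By independence of the channels the density of the joint law is the product of the densities of
the channels; a channel outside \<open>A\<close> contributes the factor \<open>1\<close>.\<close>

lemma density_sum_Z:
  assumes A: "A \<subseteq> {1..K}" and t: "1 \<le> t"
  shows "restr_to_subalg (law A) (G t) =
    density (restr_to_subalg (law {}) (G t)) (\<lambda>\<omega>. ennreal (exp (\<Sum>k\<in>A. Z k t \<omega>)))"
proof -
  define f where "f k x = (if k \<in> A then ennreal (exp (local_llr (S k) (P0 k) (P1 k) t x)) else 1)" for k x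
  have sub: "subalgebra (P0 k) (local_filtration (S k) t)" "subalgebra (P1 k) (local_filtration (S k) t)"
    if "k \<in> {1..K}" for k
    using subalgebra_chan[OF that, of "{}" t] subalgebra_chan[OF that, of "{k}" t] by simp_all
  have "PiM {1..K} (\<lambda>k. restr_to_subalg (chan A k) (local_filtration (S k) t))
     = density (PiM {1..K} (\<lambda>k. restr_to_subalg (chan {} k) (local_filtration (S k) t)))
         (\<lambda>\<omega>. \<Prod>k\<in>{1..K}. f k (\<omega> k))"
  proof (rule PiM_density)
    fix k assume k: "k \<in> {1..K}"
    show "prob_space (restr_to_subalg (chan {} k) (local_filtration (S k) t))"
      using prob_space_restr_to_subalg[OF subalgebra_chan[OF k] prob_chan[OF k]] .
    show "prob_space (restr_to_subalg (chan A k) (local_filtration (S k) t))"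
      using prob_space_restr_to_subalg[OF subalgebra_chan[OF k] prob_chan[OF k]] .
    have [measurable]: "local_llr (S k) (P0 k) (P1 k) t \<in> borel_measurable (restr_to_subalg (P0 k) (local_filtration (S k) t))"
      by (rule measurable_in_subalg[OF sub(1)[OF k] measurable_local_llr[OF k]])
    show "f k \<in> borel_measurable (restr_to_subalg (chan {} k) (local_filtration (S k) t))"
      unfolding f_def by simp
    show "restr_to_subalg (chan A k) (local_filtration (S k) t)
        = density (restr_to_subalg (chan {} k) (local_filtration (S k) t)) (f k)"
      using density_exp_llr[OF prob0[OF k] prob1[OF k] sub[OF k] ac01[OF k t] ac10[OF k t]]
      by (simp add: f_def[abs_def] local_llr_def density_1)
  qed simp
  moreover have "(\<Prod>k\<in>{1..K}. f k (\<omega> k)) = ennreal (exp (\<Sum>k\<in>A. Z k t \<omega>))" for \<omega>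
  proof -
    have "(\<Prod>k\<in>{1..K}. f k (\<omega> k)) = (\<Prod>k\<in>A. ennreal (exp (Z k t \<omega>)))"
      using A by (intro prod.mono_neutral_cong_right) (auto simp: f_def Z_def)
    also have "\<dots> = ennreal (exp (\<Sum>k\<in>A. Z k t \<omega>))"
      using finite_subset[OF A finite_atLeastAtMost] by (simp add: prod_ennreal exp_sum)
    finally show ?thesis .
  qed
  ultimately show ?thesis by (simp add: restr_law)
qed

abbreviation ZA :: "nat set \<Rightarrow> nat \<Rightarrow> (nat \<Rightarrow> nat \<Rightarrow> 'a) \<Rightarrow> real" where
  "ZA A t \<equiv> global_llr K S P0 P1 A t"

lemma measurable_ZA [measurable]: "ZA A t \<in> borel_measurable (G t)"
  unfolding global_llr_def by (rule measurable_llr[OF subalgebra_law])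

lemma measurable_sum_Z [measurable]:
  "A \<subseteq> {1..K} \<Longrightarrow> (\<lambda>\<omega>. \<Sum>k\<in>A. Z k t \<omega>) \<in> borel_measurable (G t)"
  by (rule borel_measurable_sum) (auto intro: measurable_Z)

lemma AE_law_of_null:
  assumes A: "A \<subseteq> {1..K}" and t: "1 \<le> t" and P: "AE \<omega> in restr_to_subalg (law {}) (G t). P \<omega>"
  shows "AE \<omega> in law A. P \<omega>"
proof -
  have "AE \<omega> in restr_to_subalg (law A) (G t). P \<omega>"
    unfolding density_sum_Z[OF A t]
    using P measurable_in_subalg[OF subalgebra_law measurable_sum_Z[OF A]]
    by (subst AE_density) auto
  then show ?thesis by (rule AE_restr_to_subalg[OF subalgebra_law])
qed

text \<open>The density is unique up to null sets of the null law, and such a null set up to time \<open>t\<close> is null under every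
\<open>law B\<close>.\<close>

lemma global_llr_eq_sum:
  assumes A: "A \<subseteq> {1..K}" and B: "B \<subseteq> {1..K}"
  shows "AE \<omega> in law B. \<forall>t\<ge>1. ZA A t \<omega> = (\<Sum>k\<in>A. Z k t \<omega>)"
proof -
  have "AE \<omega> in law B. ZA A t \<omega> = (\<Sum>k\<in>A. Z k t \<omega>)" if t: "1 \<le> t" for t
    unfolding global_llr_def
    by (rule AE_law_of_null[OF B t])
       (rule llr_eqI[OF prob_law subalgebra_law measurable_sum_Z[OF A] density_sum_Z[OF A t]])
  then have "AE \<omega> in law B. \<forall>t. 1 \<le> t \<longrightarrow> ZA A t \<omega> = (\<Sum>k\<in>A. Z k t \<omega>)"
    by (auto simp: AE_all_countable)
  then show ?thesis by simp
qed

lemma density_global_llr: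
  assumes A: "A \<subseteq> {1..K}" and t: "1 \<le> t"
  shows "restr_to_subalg (law A) (G t) =
    density (restr_to_subalg (law {}) (G t)) (\<lambda>\<omega>. ennreal (exp (ZA A t \<omega>)))"
  unfolding density_sum_Z[OF A t]
proof (rule density_cong)
  show "(\<lambda>\<omega>. ennreal (exp (\<Sum>k\<in>A. Z k t \<omega>))) \<in> borel_measurable (restr_to_subalg (law {}) (G t))"
    using measurable_in_subalg[OF subalgebra_law measurable_sum_Z[OF A]] by measurable
  show "(\<lambda>\<omega>. ennreal (exp (ZA A t \<omega>))) \<in> borel_measurable (restr_to_subalg (law {}) (G t))"
    using measurable_in_subalg[OF subalgebra_law measurable_ZA] by measurable
  show "AE \<omega> in restr_to_subalg (law {}) (G t).
      ennreal (exp (\<Sum>k\<in>A. Z k t \<omega>)) = ennreal (exp (ZA A t \<omega>))"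
    using llr_eqI[OF prob_law subalgebra_law measurable_sum_Z[OF A] density_sum_Z[OF A t]]
    unfolding global_llr_def by eventually_elim simp
qed

lemma law_le_exp:
  assumes "A \<subseteq> {1..K}" "1 \<le> t" "E \<in> sets (G t)"
  shows law_le_exp_null: "(\<And>\<omega>. \<omega> \<in> E \<Longrightarrow> ZA A t \<omega> \<le> x) \<Longrightarrow> measure (law A) E \<le> exp x * measure (law {}) E"
    and null_le_exp_law: "(\<And>\<omega>. \<omega> \<in> E \<Longrightarrow> - x \<le> ZA A t \<omega>) \<Longrightarrow> measure (law {}) E \<le> exp x * measure (law A) E"
  using measure_le_exp[OF prob_law prob_law subalgebra_law subalgebra_law measurable_ZA
    density_global_llr[OF assms(1,2)] assms(3)] by blast+

end

section \<open>Independence across channels and time\<close>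

text \<open>Independence over time within each channel and independence of the channels together give joint
independence over \<open>I \<times> J\<close>: the probability of a finite intersection factorises first over the
channels and then, in each channel, over the times that occur.\<close>

lemma indep_vars_PiM_Times:
  assumes "finite I" and M: "\<And>i. i \<in> I \<Longrightarrow> prob_space (M i)"
    and X: "\<And>i. i \<in> I \<Longrightarrow> prob_space.indep_vars (M i) (\<lambda>_. N) (X i) J"
  shows "prob_space.indep_vars (PiM I M) (\<lambda>_. N) (\<lambda>(i, j) \<omega>. X i j (\<omega> i)) (I \<times> J)"
proof -
  interpret P: prob_space "PiM I M" by (rule prob_space_PiM) (rule M)
  have rv: "X i j \<in> measurable (M i) N" if "i \<in> I" "j \<in> J" for i j
  proof -
    interpret m: prob_space "M i" by (rule M) fact
    show ?thesis using X[OF that(1)] that(2) unfolding m.indep_vars_def by blast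
  qed
  have rv': "(\<lambda>\<omega>. X i j (\<omega> i)) \<in> measurable (PiM I M) N" if "i \<in> I" "j \<in> J" for i j
    by (rule measurable_compose[of "\<lambda>\<omega>. \<omega> i" _ "M i"]) (use that rv in auto)
  show ?thesis
    unfolding P.indep_vars_def2
  proof (intro conjI ballI P.indep_setsI)
    show "(case ij of (i, j) \<Rightarrow> \<lambda>\<omega>. X i j (\<omega> i)) \<in> measurable (PiM I M) N" if "ij \<in> I \<times> J" for ij
      using that rv' by auto
    show "{(case ij of (i, j) \<Rightarrow> \<lambda>\<omega>. X i j (\<omega> i)) -` A \<inter> space (PiM I M) |A. A \<in> sets N} \<subseteq> P.events"
      if "ij \<in> I \<times> J" for ij
      using that rv' by (auto intro!: measurable_sets)
    fix A H
    assume H: "H \<noteq> {}" "H \<subseteq> I \<times> J" "finite H"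
      and "\<forall>ij\<in>H. A ij \<in> {(case ij of (i, j) \<Rightarrow> \<lambda>\<omega>. X i j (\<omega> i)) -` B \<inter> space (PiM I M) |B. B \<in> sets N}"
    then have "\<forall>ij\<in>H. \<exists>B. B \<in> sets N \<and> A ij = (\<lambda>\<omega>. X (fst ij) (snd ij) (\<omega> (fst ij))) -` B \<inter> space (PiM I M)"
      by (auto simp: case_prod_beta)
    then obtain B where B: "\<And>ij. ij \<in> H \<Longrightarrow> B ij \<in> sets N"
        "\<And>i j. (i, j) \<in> H \<Longrightarrow> A (i, j) = (\<lambda>\<omega>. X i j (\<omega> i)) -` B (i, j) \<inter> space (PiM I M)"
      by (metis fst_conv snd_conv)
    \<comment> \<open>in channel \<open>i\<close> the intersection constrains the times \<open>R i\<close>; it does not constrain channels with \<open>R i = {}\<close>\<close>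
    define R where "R i = {j. (i, j) \<in> H}" for i
    define C where "C i j = X i j -` B (i, j) \<inter> space (M i)" for i j
    define E where "E i = (if R i = {} then space (M i) else (\<Inter>j\<in>R i. C i j))" for i
    have HS: "H = (SIGMA i:I. R i)" using H by (auto simp: R_def)
    have finR: "finite (R i)" for i
    proof -
      have "R i \<subseteq> snd ` H" by (force simp: R_def)
      then show ?thesis using H(3) finite_surj by blast
    qed
    have RJ: "R i \<subseteq> J" for i using H(2) by (auto simp: R_def)
    have C: "C i j \<in> sets (M i)" if "i \<in> I" "j \<in> R i" for i j
      unfolding C_def using that H(2) B(1)
      by (intro measurable_sets[OF rv]) (auto simp: R_def)
    have E: "E i \<in> sets (M i)" if "i \<in> I" for i
      unfolding E_def using C[OF that] finR by (auto intro!: sets.finite_INT)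
    have mE: "measure (M i) (E i) = (\<Prod>j\<in>R i. measure (M i) (C i j))" if "i \<in> I" for i
    proof (cases "R i = {}")
      case True
      then show ?thesis by (simp add: E_def prob_space.prob_space[OF M[OF that]])
    next
      case False
      have "measure (M i) (\<Inter>j\<in>R i. C i j) = (\<Prod>j\<in>R i. measure (M i) (C i j))"
        unfolding C_def
        by (rule prob_space.indep_varsD[OF M[OF that] X[OF that] False finR RJ])
           (use B(1) in \<open>auto simp: R_def\<close>)
      then show ?thesis using False by (simp add: E_def)
    qed
    have mP: "measure (PiM I M) (PiE I D) = (\<Prod>i\<in>I. measure (M i) (D i))"
      if "\<And>i. i \<in> I \<Longrightarrow> D i \<in> sets (M i)" for D
    proof -
      have "emeasure (PiM I M) (PiE I D) = (\<Prod>i\<in>I. emeasure (M i) (D i))"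
        by (rule emeasure_PiM_PiE[OF \<open>finite I\<close> M that])
      moreover have "(\<Prod>i\<in>I. emeasure (M i) (D i)) = ennreal (\<Prod>i\<in>I. measure (M i) (D i))"
        by (simp add: finite_measure.emeasure_eq_measure[OF prob_space.finite_measure[OF M]] prod_ennreal)
      ultimately have "ennreal (measure (PiM I M) (PiE I D)) = ennreal (\<Prod>i\<in>I. measure (M i) (D i))"
        by (simp add: P.emeasure_eq_measure)
      then show ?thesis by (simp add: prod_nonneg)
    qed
    have "(\<Inter>ij\<in>H. A ij) = PiE I E"
    proof (rule set_eqI)
      fix \<omega>
      obtain i0 j0 where 0: "(i0, j0) \<in> H" using H(1) by auto
      show "\<omega> \<in> (\<Inter>ij\<in>H. A ij) \<longleftrightarrow> \<omega> \<in> PiE I E"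
      proof
        assume *: "\<omega> \<in> (\<Inter>ij\<in>H. A ij)"
        then have sp: "\<omega> \<in> space (PiM I M)" using 0 B(2) by blast
        have "\<omega> i \<in> E i" if "i \<in> I" for i
          using * B(2) sp that by (auto simp: E_def C_def R_def space_PiM PiE_def)
        then show "\<omega> \<in> PiE I E" using sp by (auto simp: space_PiM PiE_def)
      next
        assume *: "\<omega> \<in> PiE I E"
        then have sp: "\<omega> \<in> space (PiM I M)"
          using sets.sets_into_space[OF E] by (auto simp: space_PiM PiE_def Pi_def)
        have "\<omega> \<in> A (i, j)" if "(i, j) \<in> H" for i j
        proof -
          have "i \<in> I" "j \<in> R i" using that H(2) by (auto simp: R_def)
          then have "\<omega> i \<in> C i j" using * by (auto simp: E_def PiE_def Pi_def split: if_splits)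
          then show ?thesis using B(2)[OF that] sp by (auto simp: C_def)
        qed
        then show "\<omega> \<in> (\<Inter>ij\<in>H. A ij)" by auto
      qed
    qed
    then have "P.prob (\<Inter>ij\<in>H. A ij) = (\<Prod>i\<in>I. \<Prod>j\<in>R i. measure (M i) (C i j))"
      using mP[of E] E mE by simp
    also have "\<dots> = (\<Prod>(i, j)\<in>H. measure (M i) (C i j))"
      unfolding HS by (rule prod.Sigma) (use \<open>finite I\<close> finR in auto)
    also have "\<dots> = (\<Prod>ij\<in>H. P.prob (A ij))"
    proof (rule prod.cong[OF refl])
      fix ij assume ij: "ij \<in> H"
      obtain i j where [simp]: "ij = (i, j)" by force
      have iI: "i \<in> I" "j \<in> R i" using ij H(2) by (auto simp: R_def)
      have "measure (M i) (C i j) = measure (distr (PiM I M) (M i) (\<lambda>\<omega>. \<omega> i)) (C i j)"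
        using distr_PiM_component[of I M i] M iI by simp
      also have "\<dots> = P.prob ((\<lambda>\<omega>. \<omega> i) -` C i j \<inter> space (PiM I M))"
        by (rule measure_distr) (use C iI in auto)
      also have "(\<lambda>\<omega>. \<omega> i) -` C i j \<inter> space (PiM I M) = A ij"
        using ij iI B(2) by (auto simp: C_def space_PiM)
      finally show "(case ij of (i, j) \<Rightarrow> measure (M i) (C i j)) = P.prob (A ij)" by simp
    qed
    finally show "P.prob (\<Inter>ij\<in>H. A ij) = (\<Prod>ij\<in>H. P.prob (A ij))" .
  qed
qed

locale channels_indep = channels +
  assumes indep0: "\<And>k. k \<in> {1..K} \<Longrightarrow>
      prob_space.indep_vars (P0 k) (\<lambda>_. borel) (llr_increment (S k) (P0 k) (P1 k)) {1..}"
    and indep1: "\<And>k. k \<in> {1..K} \<Longrightarrow>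
      prob_space.indep_vars (P1 k) (\<lambda>_. borel) (llr_increment (S k) (P0 k) (P1 k)) {1..}"
begin

text \<open>The processes up to time \<open>t\<close> are partial sums of increments in \<open>(0, t]\<close>, the differences
\<open>Z k u - Z k t\<close> are sums of increments in \<open>(t, u]\<close>, and these are disjoint blocks of an independent
family.\<close>

lemma indep_past_future:
  assumes \<Phi>: "Measurable.pred (PiM ({1..K} \<times> {1..t}) (\<lambda>_. borel)) \<Phi>"
    and \<Psi>: "Measurable.pred (PiM {1..K} (\<lambda>_. borel :: real measure)) \<Psi>"
    and t: "1 \<le> t" "t \<le> u"
  shows "\<P>(\<omega> in law A. \<Phi> (\<lambda>(k, s)\<in>{1..K} \<times> {1..t}. Z k s \<omega>) \<and> \<Psi> (\<lambda>k\<in>{1..K}. Z k u \<omega> - Z k t \<omega>))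
    = \<P>(\<omega> in law A. \<Phi> (\<lambda>(k, s)\<in>{1..K} \<times> {1..t}. Z k s \<omega>)) * \<P>(\<omega> in law A. \<Psi> (\<lambda>k\<in>{1..K}. Z k u \<omega> - Z k t \<omega>))"
proof -
  interpret P: prob_space "law A" by (rule prob_law)
  define X where "X = (\<lambda>(k, s) \<omega>. llr_increment (S k) (P0 k) (P1 k) s (\<omega> k :: nat \<Rightarrow> 'a))"
  \<comment> \<open>the increment at time \<open>1\<close> is taken from \<open>0\<close>, not from the value of the likelihood ratio at time \<open>0\<close>\<close>
  define L where "L k s \<omega> = (if s = 0 then 0 else Z k s \<omega>)" for k s \<omega>
  have ind: "P.indep_vars (\<lambda>_. borel) X ({1..K} \<times> {1..})"
    unfolding X_def joint_law_def
    by (rule indep_vars_PiM_Times) (use prob0 prob1 indep0 indep1 in auto)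
  have tele: "(\<Sum>r\<in>{a<..b}. X (k, r) \<omega>) = L k b \<omega> - L k a \<omega>" if "a \<le> b" for a b k \<omega>
    using that
  proof (induction b)
    case (Suc b)
    show ?case
    proof (cases "a = Suc b")
      case False
      then have "{a<..Suc b} = insert (Suc b) {a<..b}" "a \<le> b" using Suc.prems by auto
      then show ?thesis using Suc.IH
        by (simp add: X_def L_def llr_increment_def Z_def)
    qed simp
  qed simp
  let ?A = "{1..K} \<times> {1..t}" and ?B = "{1..K} \<times> {t<..u}"
  let ?PA = "PiM ?A (\<lambda>_. borel :: real measure)" and ?PB = "PiM ?B (\<lambda>_. borel :: real measure)"
  define f where "f x = (\<lambda>(k, s)\<in>?A. \<Sum>r\<in>{0<..s}. x (k, r) :: real)" for x :: "nat \<times> nat \<Rightarrow> real"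
  define g where "g x = (\<lambda>k\<in>{1..K}. \<Sum>r\<in>{t<..u}. x (k, r) :: real)" for x :: "nat \<times> nat \<Rightarrow> real"
  have f: "f \<in> measurable ?PA ?PA"
    unfolding f_def case_prod_beta
    by (intro measurable_restrict borel_measurable_sum measurable_component_singleton) auto
  have g: "g \<in> measurable ?PB (PiM {1..K} (\<lambda>_. borel))"
    unfolding g_def
    by (intro measurable_restrict borel_measurable_sum measurable_component_singleton) auto
  have "P.indep_var ?PA (\<lambda>\<omega>. restrict (\<lambda>i. X i \<omega>) ?A) ?PB (\<lambda>\<omega>. restrict (\<lambda>i. X i \<omega>) ?B)"
    by (rule P.indep_var_restrict[OF ind]) auto
  from P.indep_var_compose[OF this measurable_compose[OF f \<Phi>] measurable_compose[OF g \<Psi>]]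
  have iv: "P.indep_var (count_space UNIV) (\<lambda>\<omega>. \<Phi> (f (restrict (\<lambda>i. X i \<omega>) ?A)))
      (count_space UNIV) (\<lambda>\<omega>. \<Psi> (g (restrict (\<lambda>i. X i \<omega>) ?B)))"
    by (simp add: comp_def)
  have fX: "f (restrict (\<lambda>i. X i \<omega>) ?A) = (\<lambda>(k, s)\<in>?A. Z k s \<omega>)" for \<omega>
  proof -
    have "(\<Sum>r\<in>{0<..s}. restrict (\<lambda>i. X i \<omega>) ?A (k, r)) = Z k s \<omega>" if "k \<in> {1..K}" "s \<in> {1..t}" for k s
    proof -
      have "(\<Sum>r\<in>{0<..s}. restrict (\<lambda>i. X i \<omega>) ?A (k, r)) = (\<Sum>r\<in>{0<..s}. X (k, r) \<omega>)"
        using that by (intro sum.cong) auto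
      then show ?thesis using that tele[of 0 s k \<omega>] by (simp add: L_def)
    qed
    then show ?thesis by (auto simp: f_def fun_eq_iff)
  qed
  have gX: "g (restrict (\<lambda>i. X i \<omega>) ?B) = (\<lambda>k\<in>{1..K}. Z k u \<omega> - Z k t \<omega>)" for \<omega>
  proof -
    have "(\<Sum>r\<in>{t<..u}. restrict (\<lambda>i. X i \<omega>) ?B (k, r)) = Z k u \<omega> - Z k t \<omega>" if "k \<in> {1..K}" for k
    proof -
      have "(\<Sum>r\<in>{t<..u}. restrict (\<lambda>i. X i \<omega>) ?B (k, r)) = (\<Sum>r\<in>{t<..u}. X (k, r) \<omega>)"
        using that by (intro sum.cong) auto
      then show ?thesis using t tele[of t u k \<omega>] by (simp add: L_def)
    qed
    then show ?thesis by (auto simp: g_def fun_eq_iff)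
  qed
  show ?thesis
    using P.indep_varD[OF iv, of "{True}" "{True}"]
    unfolding fX gX by (simp add: vimage_def Int_def conj_ac)
qed

end

section \<open>Moments of first passage times\<close>

lemma (in prob_space) prob_tendsto_0:
  assumes [measurable]: "\<And>n. A n \<in> events" and "AE \<omega> in M. eventually (\<lambda>n. \<omega> \<notin> A n) sequentially"
  shows "(\<lambda>n. prob (A n)) \<longlonglongrightarrow> 0"
proof -
  have "(\<lambda>n. \<integral>\<omega>. indicator (A n) \<omega> \<partial>M) \<longlonglongrightarrow> (\<integral>\<omega>. (0 :: real) \<partial>M)"
  proof (rule integral_dominated_convergence[where w = "\<lambda>_. 1 :: real"])
    show "AE \<omega> in M. (\<lambda>n. indicator (A n) \<omega> :: real) \<longlonglongrightarrow> 0"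
      using assms(2)
    proof eventually_elim
      case (elim \<omega>)
      then show ?case
        by (intro tendsto_eventually) (auto elim!: eventually_mono)
    qed
  qed (auto simp: indicator_def)
  then show ?thesis by simp
qed

lemma power_mult_exp_decay:
  fixes c \<delta> :: real
  assumes "0 < c" "0 < \<delta>"
  shows "eventually (\<lambda>x::nat. a * exp (- (c * real x)) * real x ^ n \<le> \<delta>) sequentially"
proof -
  have "((\<lambda>x::real. x ^ n / exp x) \<longlongrightarrow> 0) at_top"
    by (rule tendsto_power_div_exp_0)
  moreover have "filterlim (\<lambda>x::nat. c * real x) at_top sequentially"
    using assms by (intro filterlim_tendsto_pos_mult_at_top[OF tendsto_const _ filterlim_real_sequentially])
  ultimately have "((\<lambda>x::nat. (c * real x) ^ n / exp (c * real x)) \<longlongrightarrow> 0) sequentially"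
    by (rule filterlim_compose)
  from tendsto_mult_right[OF this, of "a / c ^ n"]
  have "((\<lambda>x::nat. a * exp (- (c * real x)) * real x ^ n) \<longlongrightarrow> 0) sequentially"
    using assms by (simp add: power_mult_distrib exp_minus field_simps)
  then show ?thesis
    using assms(2) by (auto dest!: order_tendstoD(2)[of _ _ _ \<delta>] elim!: eventually_mono)
qed

text \<open>Discretisation of the tail of a moment: beyond \<open>T\<close> the value \<open>n\<close> lies in a unique dyadic block
\<open>(2 ^ j * T, 2 ^ Suc j * T]\<close>. If \<open>n = \<infinity>\<close>, all terms of the series are present and, as \<open>q \<ge> 1\<close>, it diverges.\<close>

lemma enat_power_le_dyadic:
  fixes T q :: nat
  assumes T: "1 \<le> T" and q: "1 \<le> q"
    and B: "\<And>j. enat (2 ^ j * T) < n \<Longrightarrow> x \<in> B j"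
  shows "ennreal_of_enat n ^ q \<le> ennreal (real T ^ q)
    + (\<Sum>j. ennreal ((2 ^ Suc j * real T) ^ q) * indicator (B j) x)"
proof -
  let ?f = "\<lambda>j. ennreal ((2 ^ Suc j * real T) ^ q) * indicator (B j) x"
  have single: "?f j \<le> suminf ?f" for j
  proof -
    have "sum ?f {j} \<le> suminf ?f" by (rule sum_le_suminf) auto
    moreover have "sum ?f {j} = ?f j" by (subst sum.insert) simp_all
    ultimately show ?thesis by simp
  qed
  show ?thesis
  proof (cases n)
    case (enat n')
    have n: "ennreal_of_enat n ^ q = ennreal (real n' ^ q)"
      by (simp add: enat ennreal_of_nat_eq_real_of_nat ennreal_power)
    show ?thesis
    proof (cases "n' \<le> T")
      case True
      then have "ennreal (real n' ^ q) \<le> ennreal (real T ^ q)"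
        by (intro ennreal_leI power_mono) auto
      then show ?thesis unfolding n by (rule add_increasing2[rotated]) simp
    next
      case False
      have ex: "\<exists>j. n' \<le> 2 ^ Suc j * T"
      proof
        have "n' \<le> 2 ^ n'" by (simp add: less_imp_le)
        also have "\<dots> \<le> 2 ^ Suc n' * T" using T by (intro order_trans[OF _ mult_le_mono[OF order_refl T]]) simp
        finally show "n' \<le> 2 ^ Suc n' * T" .
      qed
      define j where "j = (LEAST j. n' \<le> 2 ^ Suc j * T)"
      have j: "n' \<le> 2 ^ Suc j * T" unfolding j_def by (rule LeastI_ex[OF ex])
      have "2 ^ j * T < n'"
      proof (cases j)
        case (Suc i)
        then have "\<not> n' \<le> 2 ^ Suc i * T" using not_less_Least[of i "\<lambda>j. n' \<le> 2 ^ Suc j * T"] j_def by simp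
        then show ?thesis using Suc by simp
      qed (use False in simp)
      then have xB: "x \<in> B j" using B enat by simp
      have "real n' \<le> real (2 ^ Suc j * T)" using j by (rule of_nat_mono)
      then have "ennreal (real n' ^ q) \<le> ennreal ((2 ^ Suc j * real T) ^ q)"
        by (intro ennreal_leI power_mono) auto
      also have "\<dots> = ?f j" using xB by simp
      also note single[of j]
      finally show ?thesis unfolding n by (rule add_increasing[rotated]) simp
    qed
  next
    case infinity
    have "of_nat j \<le> suminf ?f" for j
    proof -
      have "real j \<le> 2 ^ Suc j * real T"
      proof -
        have "real j \<le> 2 ^ j" using of_nat_less_two_power[of j, where 'a = real] by (rule less_imp_le)
        also have "\<dots> \<le> 2 ^ Suc j * 1" by simp
        also have "\<dots> \<le> 2 ^ Suc j * real T" using T by (intro mult_left_mono) auto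
        finally show ?thesis .
      qed
      also have "\<dots> \<le> (2 ^ Suc j * real T) ^ q"
      proof (rule self_le_power)
        show "1 \<le> 2 ^ Suc j * real T" using mult_mono[of 1 "2 ^ Suc j" 1 "real T"] T one_le_power[of "2::real" "Suc j"] by simp
      qed (use q in simp)
      finally have "of_nat j \<le> ?f j" using B[of j] infinity
        by (simp add: ennreal_of_nat_eq_real_of_nat ennreal_leI)
      then show ?thesis using single[of j] by (rule order_trans)
    qed
    then have "(SUP j. of_nat j) \<le> suminf ?f" by (intro SUP_least)
    then have "suminf ?f = \<top>" by (simp add: ennreal_SUP_of_nat_eq_top top_unique)
    then show ?thesis by simp
  qed
qed

text \<open>Processes that drift upwards with speed at least \<open>J\<close>, and of which exponential lower tails and
independence of \<open>(t, 2t]\<close> from the past are known. The quantity of interest is the first time at which all of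
them are at least \<open>b\<close>. Index sets with several elements are needed under the null law, where every
\<open>- Z\<^sup>A\<close> has to reach the level.\<close>

locale first_passage = prob_space +
  fixes W :: "'i \<Rightarrow> nat \<Rightarrow> 'a \<Rightarrow> real" and I :: "'i set" and m :: "'i \<Rightarrow> real" and J :: real
  assumes fin: "finite I"
    and J_pos: "0 < J" and J_le: "\<And>i. i \<in> I \<Longrightarrow> J \<le> m i"
    and meas [measurable]: "\<And>i t. i \<in> I \<Longrightarrow> W i t \<in> borel_measurable M"
    and lln: "\<And>i. i \<in> I \<Longrightarrow> AE \<omega> in M. (\<lambda>t. W i t \<omega> / real t) \<longlonglongrightarrow> m i"
    and exp_tail: "\<And>i t x. i \<in> I \<Longrightarrow> 1 \<le> t \<Longrightarrow> \<P>(\<omega> in M. W i t \<omega> < - x) \<le> exp (- x)"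
    and indep: "\<And>t b c. 1 \<le> t \<Longrightarrow>
      \<P>(\<omega> in M. (\<forall>s\<in>{1..t}. \<exists>i\<in>I. W i s \<omega> < b) \<and> (\<exists>i\<in>I. W i (2 * t) \<omega> - W i t \<omega> < c))
      = \<P>(\<omega> in M. \<forall>s\<in>{1..t}. \<exists>i\<in>I. W i s \<omega> < b) * \<P>(\<omega> in M. \<exists>i\<in>I. W i (2 * t) \<omega> - W i t \<omega> < c)"
begin

text \<open>The event that the first passage over \<open>b\<close> happens after time \<open>t\<close>.\<close>

definition below :: "real \<Rightarrow> nat \<Rightarrow> 'a set" where
  "below b t = {\<omega> \<in> space M. \<forall>s\<in>{1..t}. \<exists>i\<in>I. W i s \<omega> < b}"

lemma below_events [measurable]: "below b t \<in> events"
  unfolding below_def using fin by measurable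

lemma slow_tendsto_0:
  assumes "c < J"
  shows "(\<lambda>t. \<P>(\<omega> in M. \<exists>i\<in>I. W i t \<omega> < c * real t)) \<longlonglongrightarrow> 0"
proof (rule prob_tendsto_0)
  show "{\<omega> \<in> space M. \<exists>i\<in>I. W i t \<omega> < c * real t} \<in> events" for t
    using fin by measurable
  have "AE \<omega> in M. \<forall>i\<in>I. (\<lambda>t. W i t \<omega> / real t) \<longlonglongrightarrow> m i"
    using lln by (simp add: AE_finite_all fin)
  then show "AE \<omega> in M. \<forall>\<^sub>F t in sequentially. \<omega> \<notin> {\<omega> \<in> space M. \<exists>i\<in>I. W i t \<omega> < c * real t}"
  proof eventually_elim
    case (elim \<omega>)
    have "\<forall>\<^sub>F t in sequentially. \<forall>i\<in>I. c < W i t \<omega> / real t"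
      using elim assms J_le by (intro eventually_ball_finite fin ballI order_tendstoD) force+
    then show ?case
      using eventually_gt_at_top[of 0]
      by eventually_elim (auto simp: field_simps not_less less_imp_le)
  qed
qed

lemma slow_increment_tendsto_0:
  assumes "c < J"
  shows "(\<lambda>t. \<P>(\<omega> in M. \<exists>i\<in>I. W i (2 * t) \<omega> - W i t \<omega> < c * real t)) \<longlonglongrightarrow> 0"
proof (rule prob_tendsto_0)
  show "{\<omega> \<in> space M. \<exists>i\<in>I. W i (2 * t) \<omega> - W i t \<omega> < c * real t} \<in> events" for t
    using fin by measurable
  have "AE \<omega> in M. \<forall>i\<in>I. (\<lambda>t. W i t \<omega> / real t) \<longlonglongrightarrow> m i"
    using lln by (simp add: AE_finite_all fin)
  then show "AE \<omega> in M. \<forall>\<^sub>F t in sequentially.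
      \<omega> \<notin> {\<omega> \<in> space M. \<exists>i\<in>I. W i (2 * t) \<omega> - W i t \<omega> < c * real t}"
  proof eventually_elim
    case (elim \<omega>)
    have "\<forall>\<^sub>F t in sequentially. \<forall>i\<in>I. c < 2 * (W i (2 * t) \<omega> / real (2 * t)) - W i t \<omega> / real t"
    proof (intro eventually_ball_finite fin ballI)
      fix i assume i: "i \<in> I"
      have l: "(\<lambda>t. W i t \<omega> / real t) \<longlonglongrightarrow> m i" using elim i by blast
      have "filterlim (\<lambda>t::nat. 2 * t) sequentially sequentially"
        by (rule filterlim_subseq) (auto simp: strict_mono_def)
      from filterlim_compose[OF l this]
      have "(\<lambda>t. W i (2 * t) \<omega> / real (2 * t)) \<longlonglongrightarrow> m i" .
      from tendsto_diff[OF tendsto_mult_left[OF this, of 2] l]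
      have "(\<lambda>t. 2 * (W i (2 * t) \<omega> / real (2 * t)) - W i t \<omega> / real t) \<longlonglongrightarrow> m i" by simp
      then show "\<forall>\<^sub>F t in sequentially. c < 2 * (W i (2 * t) \<omega> / real (2 * t)) - W i t \<omega> / real t"
        by (rule order_tendstoD(1)[OF _ less_le_trans[OF assms J_le[OF i]]])
    qed
    then show ?case
      using eventually_gt_at_top[of 0]
      by eventually_elim (auto simp: field_simps not_less less_imp_le)
  qed
qed

text \<open>If the passage happens after \<open>2t\<close>, some process is below \<open>b\<close> at time \<open>2t\<close>. When all increments over \<open>(t, 2t]\<close>
are at least \<open>c t\<close>, that process is below \<open>b - c t\<close> already at time \<open>t\<close>.\<close>

lemma prob_below_double:
  assumes t: "1 \<le> t"
  shows "prob (below b (2 * t)) \<le> prob (below b t) * \<P>(\<omega> in M. \<exists>i\<in>I. W i (2 * t) \<omega> - W i t \<omega> < c * real t)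
    + real (card I) * exp (- (c * real t - b))"
proof -
  let ?A = "{\<omega> \<in> space M. (\<forall>s\<in>{1..t}. \<exists>i\<in>I. W i s \<omega> < b) \<and> (\<exists>i\<in>I. W i (2 * t) \<omega> - W i t \<omega> < c * real t)}"
  let ?B = "\<lambda>i. {\<omega> \<in> space M. W i t \<omega> < - (c * real t - b)}"
  have A: "?A \<in> events" using fin by measurable
  have B: "?B i \<in> events" if "i \<in> I" for i using that by measurable
  have U: "(\<Union>i\<in>I. ?B i) \<in> events" by (rule sets.finite_UN[OF fin B])
  have pA: "prob ?A = prob (below b t) * \<P>(\<omega> in M. \<exists>i\<in>I. W i (2 * t) \<omega> - W i t \<omega> < c * real t)"
    unfolding below_def by (rule indep[OF t])
  have "below b (2 * t) \<subseteq> ?A \<union> (\<Union>i\<in>I. ?B i)"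
  proof
    fix \<omega> assume w: "\<omega> \<in> below b (2 * t)"
    then have sp: "\<omega> \<in> space M" and l: "\<forall>s\<in>{1..2 * t}. \<exists>i\<in>I. W i s \<omega> < b" by (auto simp: below_def)
    obtain i where i: "i \<in> I" "W i (2 * t) \<omega> < b" using l t by force
    show "\<omega> \<in> ?A \<union> (\<Union>i\<in>I. ?B i)"
    proof (cases "\<exists>i\<in>I. W i (2 * t) \<omega> - W i t \<omega> < c * real t")
      case True
      then show ?thesis using sp l by auto
    next
      case False
      then have "W i t \<omega> < - (c * real t - b)" using i by force
      then show ?thesis using sp i by auto
    qed
  qed
  then have "prob (below b (2 * t)) \<le> prob (?A \<union> (\<Union>i\<in>I. ?B i))"
    by (rule finite_measure_mono[OF _ sets.Un[OF A U]])
  also have "\<dots> \<le> prob ?A + prob (\<Union>i\<in>I. ?B i)"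
    by (rule measure_Un_le[OF A U])
  also have "prob (\<Union>i\<in>I. ?B i) \<le> (\<Sum>i\<in>I. prob (?B i))"
    by (rule measure_UNION_le[OF fin B])
  also have "\<dots> \<le> (\<Sum>i\<in>I. exp (- (c * real t - b)))"
    by (rule sum_mono) (rule exp_tail[OF _ t])
  also have "\<dots> = real (card I) * exp (- (c * real t - b))"
    by (rule sum_constant)
  finally show ?thesis unfolding pA by simp
qed

text \<open>Iterating the previous inequality from \<open>T\<close> on. The level may be as large as \<open>\<theta> J T\<close> with \<open>\<theta> < 1\<close>, so
that \<open>c t - b\<close> stays proportional to \<open>t\<close> for every speed \<open>c\<close> strictly between \<open>\<theta> J\<close> and \<open>J\<close>; the decay
rate \<open>2 powr (- p)\<close> per doubling is arbitrary, because the probability of a slow increment tends to \<open>0\<close>.\<close>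

lemma prob_below_geometric:
  assumes \<theta>: "0 < \<theta>" "\<theta> < 1" and \<eta>: "0 < \<eta>"
  shows "\<forall>\<^sub>F T in sequentially. \<forall>b \<le> \<theta> * J * real T. \<forall>j.
    prob (below b (2 ^ j * T)) \<le> \<eta> * (1 / 2) ^ (p * j)"
proof -
  define c where "c = (1 + \<theta>) / 2 * J"
  have c: "c < J" "0 < c - \<theta> * J" "\<theta> * J < J"
    using \<theta> J_pos by (auto simp: c_def field_simps)
  let ?\<epsilon> = "(1 / 2 :: real) ^ (p + 1)"
  have \<epsilon>: "0 < ?\<epsilon>" by simp
  have e1: "\<forall>\<^sub>F T in sequentially. \<forall>t\<ge>T. \<P>(\<omega> in M. \<exists>i\<in>I. W i (2 * t) \<omega> - W i t \<omega> < c * real t) < ?\<epsilon>"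
    using order_tendstoD(2)[OF slow_increment_tendsto_0[OF c(1)] \<epsilon>]
    by (simp add: eventually_all_ge_at_top)
  have e2: "\<forall>\<^sub>F T in sequentially. \<P>(\<omega> in M. \<exists>i\<in>I. W i T \<omega> < \<theta> * J * real T) < \<eta>"
    by (rule order_tendstoD(2)[OF slow_tendsto_0[OF c(3)] \<eta>])
  have e3: "\<forall>\<^sub>F T in sequentially. \<forall>x\<ge>T. real (card I) * exp (- ((c - \<theta> * J) * real x)) * real x ^ p \<le> ?\<epsilon> * \<eta>"
    using power_mult_exp_decay[OF c(2), of "?\<epsilon> * \<eta>" "real (card I)" p] \<eta> \<epsilon>
    by (simp add: eventually_all_ge_at_top)
  show ?thesis
    using e1 e2 e3 eventually_ge_at_top[of 1]
  proof eventually_elim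
    case (elim T)
    show ?case
    proof (intro allI impI)
      fix b j assume b: "b \<le> \<theta> * J * real T"
      show "prob (below b (2 ^ j * T)) \<le> \<eta> * (1 / 2) ^ (p * j)"
      proof (induction j)
        case 0
        have "prob (below b T) \<le> \<P>(\<omega> in M. \<exists>i\<in>I. W i T \<omega> < \<theta> * J * real T)"
        proof (rule finite_measure_mono)
          show "{\<omega> \<in> space M. \<exists>i\<in>I. W i T \<omega> < \<theta> * J * real T} \<in> events" using fin by measurable
          show "below b T \<subseteq> {\<omega> \<in> space M. \<exists>i\<in>I. W i T \<omega> < \<theta> * J * real T}"
            using b elim(4) by (auto simp: below_def) (meson atLeastAtMost_iff le_refl less_le_trans)
        qed
        then show ?case using elim(2) by simp
      next
        case (Suc j)
        define t where "t = 2 ^ j * T"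
        have tT: "T \<le> t" "1 \<le> t" using elim(4) by (auto simp: t_def)
        have "real (card I) * exp (- (c * real t - b)) \<le> real (card I) * exp (- ((c - \<theta> * J) * real t))"
        proof -
          have "\<theta> * J * real T \<le> \<theta> * J * real t" using tT \<theta> J_pos by (intro mult_left_mono) auto
          then show ?thesis using b by (intro mult_left_mono) (auto simp: algebra_simps)
        qed
        also have "\<dots> \<le> \<eta> * (1 / 2) ^ (p * j) * ?\<epsilon>"
        proof -
          have "(2 ^ j) ^ p \<le> real t ^ p"
            by (rule power_mono) (use elim(4) in \<open>auto simp: t_def\<close>)
          then have "real (card I) * exp (- ((c - \<theta> * J) * real t)) * (2 ^ j) ^ p
            \<le> real (card I) * exp (- ((c - \<theta> * J) * real t)) * real t ^ p"
            by (intro mult_left_mono) auto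
          also have "\<dots> \<le> ?\<epsilon> * \<eta>" using elim(3) tT by blast
          finally show ?thesis
            by (simp add: field_simps power_mult[symmetric] mult.commute[of p j])
        qed
        finally have "real (card I) * exp (- (c * real t - b)) \<le> \<eta> * (1 / 2) ^ (p * j) * ?\<epsilon>" .
        moreover have "prob (below b t) * \<P>(\<omega> in M. \<exists>i\<in>I. W i (2 * t) \<omega> - W i t \<omega> < c * real t)
            \<le> \<eta> * (1 / 2) ^ (p * j) * ?\<epsilon>"
          using Suc.IH \<eta> elim(1)[rule_format, OF tT(1)]
          by (intro mult_mono) (auto simp: t_def[symmetric] less_imp_le simp del: power_Suc)
        ultimately have "prob (below b (2 * t)) \<le> 2 * (\<eta> * (1 / 2) ^ (p * j) * ?\<epsilon>)"
          using prob_below_double[OF tT(2), of b c] by linarith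
        also have "\<dots> = \<eta> * (1 / 2) ^ (p * Suc j)"
          by (simp add: power_add)
        finally show ?case by (simp add: t_def mult.assoc)
      qed
    qed
  qed
qed

text \<open>With decay rate \<open>2 ^ (q + 1)\<close> per doubling, the dyadic blocks beyond \<open>T\<close> contribute a geometric series,
whose sum is a small multiple of \<open>T ^ q\<close>.\<close>

lemma moment_upper_nat:
  assumes \<theta>: "0 < \<theta>" "\<theta> < 1" and \<eta>: "0 < \<eta>" and q: "1 \<le> q"
  shows "\<forall>\<^sub>F T in sequentially. \<forall>b \<le> \<theta> * J * real T. \<forall>\<tau>.
    (AE \<omega> in M. \<forall>t. enat t < \<tau> \<omega> \<longrightarrow> \<omega> \<in> below b t) \<longrightarrow>
    time_moment M q \<tau> \<le> ennreal ((1 + \<eta>) * real T ^ q)"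
proof -
  define \<eta>' where "\<eta>' = \<eta> / 2 ^ Suc q"
  have "0 < \<eta>'" using \<eta> by (simp add: \<eta>'_def)
  from prob_below_geometric[OF \<theta> this, of "Suc q"] eventually_ge_at_top[of 1] show ?thesis
  proof eventually_elim
    case (elim T)
    show ?case
    proof (intro allI impI)
      fix b \<tau> assume b: "b \<le> \<theta> * J * real T" and ae: "AE \<omega> in M. \<forall>t. enat t < \<tau> \<omega> \<longrightarrow> \<omega> \<in> below b t"
      let ?H = "\<lambda>j. below b (2 ^ j * T)"
      have "time_moment M q \<tau> \<le> (\<integral>\<^sup>+\<omega>. ennreal (real T ^ q)
          + (\<Sum>j. ennreal ((2 ^ Suc j * real T) ^ q) * indicator (?H j) \<omega>) \<partial>M)"
        unfolding time_moment_def
        by (rule nn_integral_mono_AE)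
           (use ae in \<open>eventually_elim, intro enat_power_le_dyadic[OF elim(2) q], blast\<close>)
      also have "\<dots> = ennreal (real T ^ q)
          + (\<Sum>j. ennreal ((2 ^ Suc j * real T) ^ q) * ennreal (prob (?H j)))"
        by (subst nn_integral_add, measurable, subst nn_integral_suminf, measurable)
           (simp add: nn_integral_cmult_indicator emeasure_eq_measure prob_space)
      also have "(\<Sum>j. ennreal ((2 ^ Suc j * real T) ^ q) * ennreal (prob (?H j)))
          \<le> (\<Sum>j. ennreal (real T ^ q * 2 ^ q * \<eta>' * (1 / 2) ^ j))"
      proof (rule suminf_le)
        fix j
        have "(2 ^ Suc j * real T) ^ q * prob (?H j) \<le> (2 ^ Suc j * real T) ^ q * (\<eta>' * (1 / 2) ^ (Suc q * j))"
          using elim(1) b by (intro mult_left_mono) auto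
        also have "\<dots> = real T ^ q * 2 ^ q * \<eta>' * (1 / 2) ^ j"
        proof -
          have "(2 ^ Suc j) ^ q * (1 / 2) ^ (Suc q * j) = (2 :: real) ^ q * (1 / 2) ^ j"
            by (simp add: power_mult_distrib power_add power_one_over power_mult[symmetric] mult.commute)
          then show ?thesis by (simp add: power_mult_distrib[of _ "real T"] algebra_simps)
        qed
        finally show "ennreal ((2 ^ Suc j * real T) ^ q) * ennreal (prob (?H j))
            \<le> ennreal (real T ^ q * 2 ^ q * \<eta>' * (1 / 2) ^ j)"
          by (simp add: ennreal_leI flip: ennreal_mult)
      qed auto
      also have "(\<Sum>j. ennreal (real T ^ q * 2 ^ q * \<eta>' * (1 / 2) ^ j)) = ennreal (real T ^ q * \<eta>)"
      proof (rule suminf_ennreal_eq)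
        show "0 \<le> real T ^ q * 2 ^ q * \<eta>' * (1 / 2) ^ j" for j using \<open>0 < \<eta>'\<close> by simp
        have "(\<lambda>j. real T ^ q * 2 ^ q * \<eta>' * (1 / 2) ^ j) sums (real T ^ q * 2 ^ q * \<eta>' * 2)"
          using geometric_sums[of "1 / 2 :: real"] by (intro sums_mult) simp
        then show "(\<lambda>j. real T ^ q * 2 ^ q * \<eta>' * (1 / 2) ^ j) sums (real T ^ q * \<eta>)"
          by (simp add: \<eta>'_def)
      qed
      also have "ennreal (real T ^ q) + ennreal (real T ^ q * \<eta>) = ennreal ((1 + \<eta>) * real T ^ q)"
        using \<eta> by (simp add: algebra_simps flip: ennreal_plus)
      finally show "time_moment M q \<tau> \<le> ennreal ((1 + \<eta>) * real T ^ q)" by (simp add: add_left_mono)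
    qed
  qed
qed

text \<open>The previous bound at the least integer \<open>T \<ge> b / (\<theta> J)\<close>. The slack \<open>\<rho>\<close> is distributed evenly,
as \<open>s\<close> with \<open>s ^ (q + 1) = \<rho>\<close>, over the factor \<open>1 + \<eta>\<close> and the \<open>q\<close> factors \<open>T\<close>.\<close>

lemma moment_upper:
  assumes \<rho>: "1 < \<rho>" and q: "1 \<le> q"
  shows "\<forall>\<^sub>F b in at_top. \<forall>\<tau>. (AE \<omega> in M. \<forall>t. enat t < \<tau> \<omega> \<longrightarrow> \<omega> \<in> below b t) \<longrightarrow>
    time_moment M q \<tau> \<le> ennreal (\<rho> * (b / J) ^ q)"
proof -
  define s where "s = root (Suc q) \<rho>"
  have s: "1 < s" using \<rho> by (simp add: s_def)
  have s_pow: "s ^ Suc q = \<rho>" unfolding s_def by (rule real_root_pow_pos2) (use \<rho> in auto)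
  define \<theta> where "\<theta> = 2 / (1 + s)"
  have \<theta>: "0 < \<theta>" "\<theta> < 1" using s by (auto simp: \<theta>_def)
  have "\<exists>T0. \<forall>T\<ge>T0. \<forall>b \<le> \<theta> * J * real T. \<forall>\<tau>.
      (AE \<omega> in M. \<forall>t. enat t < \<tau> \<omega> \<longrightarrow> \<omega> \<in> below b t) \<longrightarrow>
      time_moment M q \<tau> \<le> ennreal ((1 + (s - 1)) * real T ^ q)"
    unfolding eventually_sequentially[symmetric]
    by (rule moment_upper_nat[OF \<theta> _ q]) (use s in simp)
  then obtain T0 where T0: "\<forall>T\<ge>T0. \<forall>b \<le> \<theta> * J * real T. \<forall>\<tau>.
      (AE \<omega> in M. \<forall>t. enat t < \<tau> \<omega> \<longrightarrow> \<omega> \<in> below b t) \<longrightarrow>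
      time_moment M q \<tau> \<le> ennreal ((1 + (s - 1)) * real T ^ q)"
    by (rule exE)
  define B where "B = max 1 (max (\<theta> * J * real T0) (2 * J / (s - 1)))"
  have main: "time_moment M q \<tau> \<le> ennreal (\<rho> * (b / J) ^ q)"
    if "B \<le> b" and ae: "AE \<omega> in M. \<forall>t. enat t < \<tau> \<omega> \<longrightarrow> \<omega> \<in> below b t" for b \<tau>
  proof -
    have b: "\<theta> * J * real T0 \<le> b" "2 * J / (s - 1) \<le> b" "0 < b"
      using that(1) by (auto simp: B_def)
    define T where "T = nat \<lceil>b / (\<theta> * J)\<rceil>"
    have pos: "0 < \<theta> * J" using \<theta> J_pos by simp
    have T1: "b / (\<theta> * J) \<le> real T" by (simp add: T_def of_nat_ceiling)
    have T2: "real T \<le> b / (\<theta> * J) + 1" using b(3) pos by (simp add: T_def)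
    have "real T0 \<le> b / (\<theta> * J)" by (subst pos_le_divide_eq[OF pos]) (use b(1) in \<open>simp add: mult.commute\<close>)
    from order_trans[OF this T1] have "T0 \<le> T" by simp
    moreover have "b \<le> \<theta> * J * real T" using T1[unfolded pos_divide_le_eq[OF pos]] by (simp add: mult.commute)
    ultimately have "time_moment M q \<tau> \<le> ennreal ((1 + (s - 1)) * real T ^ q)"
      using ae by (rule T0[rule_format])
    also have "\<dots> \<le> ennreal (\<rho> * (b / J) ^ q)"
    proof (rule ennreal_leI)
      have "b / (\<theta> * J) + 1 \<le> s * (b / J)"
      proof -
        have "2 * J \<le> b * (s - 1)" using b(2) s by (simp add: pos_divide_le_eq)
        then have "2 \<le> (s - 1) * (b / J)" using J_pos by (simp add: pos_le_divide_eq mult.commute)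
        moreover have "b / (\<theta> * J) = (1 + s) / 2 * (b / J)" using s by (simp add: \<theta>_def)
        moreover have "(1 + s) / 2 * y + 1 \<le> s * y" if "2 \<le> (s - 1) * y" for y
          using that by (simp add: field_simps)
        ultimately show ?thesis by metis
      qed
      then have "real T \<le> s * (b / J)" by (rule order_trans[OF T2])
      then have "real T ^ q \<le> (s * (b / J)) ^ q" by (rule power_mono) simp
      then have "s * real T ^ q \<le> s * (s * (b / J)) ^ q" by (rule mult_left_mono) (use s in simp)
      also have "\<dots> = \<rho> * (b / J) ^ q" unfolding s_pow[symmetric] by (simp only: power_mult_distrib power_Suc mult.assoc)
      finally show "(1 + (s - 1)) * real T ^ q \<le> \<rho> * (b / J) ^ q" by simp
    qed
    finally show ?thesis .
  qed
  show ?thesis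
    unfolding eventually_at_top_linorder by (intro exI[of _ B] allI impI main)
qed

end

section \<open>Lower bounds for sequential tests\<close>

text \<open>The hypothesis on \<open>\<tau>\<close> is the bound on early stopping, where \<open>\<gamma>\<close> bounds the error probability
under \<open>M\<close> and \<open>exp (- L)\<close> the one under the alternative law. The constant \<open>\<epsilon>\<close> does not depend on \<open>\<tau>\<close>, which makes the conclusion
uniform over a class of tests.\<close>

lemma (in prob_space) moment_lower:
  fixes V :: "nat \<Rightarrow> 'a \<Rightarrow> real"
  assumes meas [measurable]: "\<And>n. V n \<in> borel_measurable M"
    and lln: "AE \<omega> in M. (\<lambda>n. V n \<omega> / real n) \<longlonglongrightarrow> J" and J: "0 < J"
    and \<rho>: "0 < \<rho>" "\<rho> < 1"
  shows "\<exists>\<epsilon>>0. \<forall>\<gamma> L \<tau>. \<gamma> \<le> \<epsilon> \<longrightarrow> 1 / \<epsilon> \<le> L \<longrightarrow>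
    (\<forall>n. {\<omega> \<in> space M. \<tau> \<omega> \<le> enat n} \<in> events) \<longrightarrow>
    (\<forall>n\<ge>1. \<forall>x. \<P>(\<omega> in M. \<tau> \<omega> \<le> enat n) \<le> \<gamma> + exp (x - L) + \<P>(\<omega> in M. x < V n \<omega>)) \<longrightarrow>
    ennreal (\<rho> * (L / J) ^ q) \<le> time_moment M q \<tau>"
proof -
  define r where "r = root (Suc q) \<rho>"
  have r: "0 < r" "r < 1" using \<rho> by (simp_all add: r_def)
  have r_pow: "r ^ Suc q = \<rho>" unfolding r_def by (rule real_root_pow_pos2) (use \<rho> in auto)
  define s where "s = (1 + r) / 2"
  have s: "r < s" "s < 1" using r by (auto simp: s_def)
  define \<delta> where "\<delta> = (1 - r) / 3"
  have \<delta>: "0 < \<delta>" "r + 3 * \<delta> = 1" using r by (simp_all add: \<delta>_def diff_divide_distrib)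
  have "(\<lambda>n. \<P>(\<omega> in M. s / r * J * real n < V n \<omega>)) \<longlonglongrightarrow> 0"
  proof (rule prob_tendsto_0)
    show "{\<omega> \<in> space M. s / r * J * real n < V n \<omega>} \<in> events" for n by measurable
    have "J < s / r * J" using r s J by (simp add: field_simps)
    show "AE \<omega> in M. \<forall>\<^sub>F n in sequentially. \<omega> \<notin> {\<omega> \<in> space M. s / r * J * real n < V n \<omega>}"
      using lln
    proof eventually_elim
      case (elim \<omega>)
      from order_tendstoD(2)[OF elim \<open>J < s / r * J\<close>] eventually_gt_at_top[of 0]
      show ?case by eventually_elim (simp add: pos_divide_less_eq)
    qed
  qed
  from order_tendstoD(2)[OF this \<delta>(1)] eventually_ge_at_top[of 1]
  have "\<forall>\<^sub>F n in sequentially. \<P>(\<omega> in M. s / r * J * real n < V n \<omega>) < \<delta> \<and> 1 \<le> n"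
    by eventually_elim simp
  then obtain n0 where n0: "\<And>n. n0 \<le> n \<Longrightarrow> \<P>(\<omega> in M. s / r * J * real n < V n \<omega>) < \<delta> \<and> 1 \<le> n"
    unfolding eventually_sequentially by blast
  \<comment> \<open>the first constraint gives \<open>n \<ge> n0\<close>, the second \<open>exp (s * L - L) \<le> \<delta>\<close>\<close>
  define C where "C = max (J / r * (real n0 + 1)) (- ln \<delta> / (1 - s))"
  define \<epsilon> where "\<epsilon> = min \<delta> (1 / max 1 C)"
  have \<epsilon>: "0 < \<epsilon>" "\<epsilon> \<le> \<delta>" "C \<le> 1 / \<epsilon>"
  proof -
    show "0 < \<epsilon>" "\<epsilon> \<le> \<delta>" using \<delta> by (auto simp: \<epsilon>_def)
    have "1 / (1 / max 1 C) \<le> 1 / \<epsilon>"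
      using \<open>0 < \<epsilon>\<close> by (intro divide_left_mono) (auto simp: \<epsilon>_def)
    then show "C \<le> 1 / \<epsilon>" by simp
  qed
  have main: "ennreal (\<rho> * (L / J) ^ q) \<le> time_moment M q \<tau>"
    if \<gamma>: "\<gamma> \<le> \<epsilon>" and L: "1 / \<epsilon> \<le> L"
      and ev: "\<forall>n. {\<omega> \<in> space M. \<tau> \<omega> \<le> enat n} \<in> events"
      and bound: "\<forall>n\<ge>1. \<forall>x. \<P>(\<omega> in M. \<tau> \<omega> \<le> enat n) \<le> \<gamma> + exp (x - L) + \<P>(\<omega> in M. x < V n \<omega>)"
    for \<gamma> L \<tau>
  proof -
    have CL: "J / r * (real n0 + 1) \<le> L" "- ln \<delta> / (1 - s) \<le> L"
      using order_trans[OF \<epsilon>(3) L] by (auto simp: C_def)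
    \<comment> \<open>rounding down suffices, since \<open>\<tau> > n\<close> means \<open>\<tau> \<ge> n + 1 \<ge> r * L / J\<close>\<close>
    define n where "n = nat \<lfloor>r * L / J\<rfloor>"
    have n0': "real n0 + 1 \<le> r * L / J"
    proof -
      have "r / J * (J / r * (real n0 + 1)) \<le> r / J * L"
        by (rule mult_left_mono[OF CL(1)]) (use r J in simp)
      then show ?thesis using r J by simp
    qed
    have nle: "real n \<le> r * L / J" and nge: "r * L / J \<le> real n + 1"
      using n0' by (auto simp: n_def)
    have n: "n0 \<le> n" using n0' nge by linarith
    have "s / r * J * real n \<le> s * L"
    proof -
      have "s / r * J * real n \<le> s / r * J * (r * L / J)"
        by (rule mult_left_mono[OF nle]) (use r s J in simp)
      then show ?thesis using r J by simp
    qed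
    then have "\<P>(\<omega> in M. s * L < V n \<omega>) \<le> \<P>(\<omega> in M. s / r * J * real n < V n \<omega>)"
      by (intro finite_measure_mono) auto
    also have "\<dots> < \<delta>" using n0[OF n] by simp
    finally have 1: "\<P>(\<omega> in M. s * L < V n \<omega>) < \<delta>" .
    have 2: "exp (s * L - L) \<le> \<delta>"
    proof -
      have "- ln \<delta> \<le> L * (1 - s)" by (rule pos_divide_le_eq[THEN iffD1, OF _ CL(2)]) (use s in simp)
      then have "s * L - L \<le> ln \<delta>" by (simp add: algebra_simps)
      then show ?thesis using \<delta>(1) by (simp add: ln_ge_iff)
    qed
    have "\<P>(\<omega> in M. \<tau> \<omega> \<le> enat n) \<le> \<gamma> + exp (s * L - L) + \<P>(\<omega> in M. s * L < V n \<omega>)"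
      using bound n0[OF n] by blast
    then have small: "\<P>(\<omega> in M. \<tau> \<omega> \<le> enat n) \<le> 1 - r" using 1 2 \<gamma> \<epsilon>(2) \<delta>(2) by linarith
    let ?B = "{\<omega> \<in> space M. \<not> \<tau> \<omega> \<le> enat n}"
    have B: "?B \<in> events" using ev by (intro sets.sets_Collect_neg) blast
    have "prob ?B = 1 - \<P>(\<omega> in M. \<tau> \<omega> \<le> enat n)"
      using ev by (intro prob_neg) blast
    then have pB: "r \<le> prob ?B" using small by simp
    have "ennreal (\<rho> * (L / J) ^ q) \<le> ennreal ((real n + 1) ^ q * prob ?B)"
    proof (rule ennreal_leI)
      have "\<rho> * (L / J) ^ q = (r * L / J) ^ q * r"
        unfolding r_pow[symmetric] times_divide_eq_right[symmetric]
        by (simp only: power_mult_distrib power_Suc mult_ac)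
      also have "\<dots> \<le> (real n + 1) ^ q * prob ?B"
        using nge pB r n0' by (intro mult_mono power_mono) auto
      finally show "\<rho> * (L / J) ^ q \<le> (real n + 1) ^ q * prob ?B" .
    qed
    also have "\<dots> = (\<integral>\<^sup>+\<omega>. ennreal ((real n + 1) ^ q) * indicator ?B \<omega> \<partial>M)"
      using B by (subst nn_integral_cmult_indicator) (simp_all add: ennreal_mult emeasure_eq_measure)
    also have "\<dots> \<le> time_moment M q \<tau>"
      unfolding time_moment_def
    proof (rule nn_integral_mono)
      fix \<omega>
      show "ennreal ((real n + 1) ^ q) * indicator ?B \<omega> \<le> ennreal_of_enat (\<tau> \<omega>) ^ q"
      proof (cases "\<omega> \<in> ?B")
        case True
        then have "enat (Suc n) \<le> \<tau> \<omega>" by (simp add: Suc_ile_eq not_le)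
        then have "ennreal_of_enat (enat (Suc n)) \<le> ennreal_of_enat (\<tau> \<omega>)"
          by (simp only: ennreal_of_enat_le_iff)
        then have "ennreal_of_enat (enat (Suc n)) ^ q \<le> ennreal_of_enat (\<tau> \<omega>) ^ q"
          by (rule power_mono) simp
        moreover have "ennreal_of_enat (enat (Suc n)) ^ q = ennreal ((real n + 1) ^ q)"
          unfolding ennreal_of_enat_enat ennreal_of_nat_eq_real_of_nat
          by (subst ennreal_power) (simp_all add: add.commute)
        ultimately show ?thesis using True by simp
      qed simp
    qed
    finally show ?thesis .
  qed
  show ?thesis
    by (rule exI[of _ \<epsilon>]) (use \<epsilon>(1) main in blast)
qed

context channels
begin

abbreviation \<Omega> :: "(nat \<Rightarrow> nat \<Rightarrow> 'a) set" where
  "\<Omega> \<equiv> \<Pi>\<^sub>E k\<in>{1..K}. space (path_space (S k))"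

lemma space_G [simp]: "space (global_filtration K S t) = \<Omega>"
  by (simp add: global_filtration_def)

lemma space_law [simp]: "space (law A) = \<Omega>"
  using subalgebra_law[of A 0] by (simp add: subalgebra_def)

lemma sets_G_law: "E \<in> sets (G t) \<Longrightarrow> E \<in> sets (law A)"
  using subalgebra_law[of A t] by (auto simp: subalgebra_def)

lemma measurable_G_law: "f \<in> measurable (G t) N \<Longrightarrow> f \<in> measurable (law A) N"
  by (rule measurable_from_subalg[OF subalgebra_law])

lemma
  assumes test: "sequential_test K S (\<tau>, d)"
  shows test_time_event: "{\<omega> \<in> \<Omega>. \<tau> \<omega> \<le> enat n} \<in> sets (G n)"
    and test_decision_event: "{\<omega> \<in> \<Omega>. d \<omega> = Some i \<and> \<tau> \<omega> \<le> enat n} \<in> sets (G n)"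
    and test_decision_law: "{\<omega> \<in> \<Omega>. d \<omega> = Some i} \<in> sets (law A)"
    and test_stopped: "\<omega> \<in> \<Omega> \<Longrightarrow> \<tau> \<omega> \<le> enat n \<Longrightarrow> d \<omega> = Some 0 \<or> d \<omega> = Some 1"
proof -
  let ?F = "global_filtration K S"
  have st: "stopping_time ?F \<tau>" and d: "d \<in> measurable (filtration.pre_sigma \<Omega> ?F \<tau>) (count_space UNIV)"
    and dec: "\<And>\<omega>. \<omega> \<in> \<Omega> \<Longrightarrow> if \<tau> \<omega> < \<infinity> then d \<omega> \<in> {Some 0, Some 1} else d \<omega> = None"
    using test by (auto simp: sequential_test_def Let_def)
  interpret filtration \<Omega> ?F by (rule filtration_global)
  show "{\<omega> \<in> \<Omega>. \<tau> \<omega> \<le> enat n} \<in> sets (G n)"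
    using stopping_timeD[OF st, of "enat n"] by (simp add: pred_def)
  have "{\<omega> \<in> \<Omega>. d \<omega> = Some i} \<in> sets (pre_sigma \<tau>)"
    using measurable_sets[OF d, of "{Some i}", unfolded space_pre_sigma]
    by (simp add: vimage_def Int_def conj_commute)
  from sets_pre_sigmaD[OF st this]
  show ev: "{\<omega> \<in> \<Omega>. d \<omega> = Some i \<and> \<tau> \<omega> \<le> enat n} \<in> sets (G n)" for n
    by (simp add: conj_assoc)
  have "{\<omega> \<in> \<Omega>. d \<omega> = Some i} = (\<Union>n. {\<omega> \<in> \<Omega>. d \<omega> = Some i \<and> \<tau> \<omega> \<le> enat n})"
  proof (intro equalityI subsetI)
    fix \<omega> assume w: "\<omega> \<in> {\<omega> \<in> \<Omega>. d \<omega> = Some i}"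
    then have "\<tau> \<omega> < \<infinity>" using dec[of \<omega>] by (auto split: if_splits)
    then obtain n where "\<tau> \<omega> = enat n" by (cases "\<tau> \<omega>") auto
    then show "\<omega> \<in> (\<Union>n. {\<omega> \<in> \<Omega>. d \<omega> = Some i \<and> \<tau> \<omega> \<le> enat n})" using w by auto
  qed auto
  then show "{\<omega> \<in> \<Omega>. d \<omega> = Some i} \<in> sets (law A)"
    using sets_G_law[OF ev] by auto
  show "d \<omega> = Some 0 \<or> d \<omega> = Some 1" if "\<omega> \<in> \<Omega>" "\<tau> \<omega> \<le> enat n"
    using dec[OF that(1)] that(2) by (cases "\<tau> \<omega>") auto
qed

text \<open>A test that stops by time \<open>n\<close> takes one of the two decisions. The correct decision is rare under the
other law, and the change of measure at time \<open>n\<close> carries this over, except where the log-likelihood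
ratio in favour of the true law exceeds \<open>x\<close>.\<close>

lemma early_stopping_bound:
  assumes test: "sequential_test K S (\<tau>, d)" and A: "A \<subseteq> {1..K}" and n: "1 \<le> n"
  shows early_stopping_null: "\<P>(\<omega> in law {}. \<tau> \<omega> \<le> enat n)
      \<le> \<P>(\<omega> in law {}. d \<omega> = Some 1) + exp x * \<P>(\<omega> in law A. d \<omega> = Some 0)
        + \<P>(\<omega> in law {}. x < - ZA A n \<omega>)" (is ?null)
    and early_stopping_signal: "\<P>(\<omega> in law A. \<tau> \<omega> \<le> enat n)
      \<le> \<P>(\<omega> in law A. d \<omega> = Some 0) + exp x * \<P>(\<omega> in law {}. d \<omega> = Some 1)
        + \<P>(\<omega> in law A. x < ZA A n \<omega>)" (is ?signal)
proof -
  let ?E = "\<lambda>i. {\<omega> \<in> \<Omega>. d \<omega> = Some i \<and> \<tau> \<omega> \<le> enat n}"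
  let ?D = "\<lambda>i. {\<omega> \<in> \<Omega>. d \<omega> = Some i}"
  have neg: "{\<omega> \<in> \<Omega>. \<not> R \<omega>} \<in> sets (G n)" if "{\<omega> \<in> \<Omega>. R \<omega>} \<in> sets (G n)" for R
  proof -
    have "{\<omega> \<in> \<Omega>. \<not> R \<omega>} = space (G n) - {\<omega> \<in> \<Omega>. R \<omega>}" by (simp only: space_G) auto
    then show ?thesis using sets.compl_sets[OF that] by simp
  qed
  have split: "measure (law B) {\<omega> \<in> \<Omega>. \<tau> \<omega> \<le> enat n}
      \<le> measure (law B) (?D i) + exp x * measure (law C) (?D j) + measure (law B) {\<omega> \<in> \<Omega>. R \<omega>}"
    if ij: "{i, j} = {0, 1}"
      and R: "{\<omega> \<in> \<Omega>. R \<omega>} \<in> sets (G n)"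
      and le: "measure (law B) (?E j \<inter> {\<omega> \<in> \<Omega>. \<not> R \<omega>}) \<le> exp x * measure (law C) (?E j \<inter> {\<omega> \<in> \<Omega>. \<not> R \<omega>})"
    for i j R B C
  proof -
    interpret B: prob_space "law B" by (rule prob_law)
    interpret C: prob_space "law C" by (rule prob_law)
    have nR: "{\<omega> \<in> \<Omega>. \<not> R \<omega>} \<in> sets (G n)"
      by (rule neg[OF R])
    have EG: "?E j \<inter> {\<omega> \<in> \<Omega>. \<not> R \<omega>} \<in> sets (G n)"
      by (rule sets.Int[OF test_decision_event[OF test] nR])
    have "{\<omega> \<in> \<Omega>. \<tau> \<omega> \<le> enat n} \<subseteq> (?D i \<union> (?E j \<inter> {\<omega> \<in> \<Omega>. \<not> R \<omega>})) \<union> {\<omega> \<in> \<Omega>. R \<omega>}"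
      using test_stopped[OF test, of _ n] ij by (auto simp: doubleton_eq_iff)
    then have "measure (law B) {\<omega> \<in> \<Omega>. \<tau> \<omega> \<le> enat n}
        \<le> measure (law B) ((?D i \<union> (?E j \<inter> {\<omega> \<in> \<Omega>. \<not> R \<omega>})) \<union> {\<omega> \<in> \<Omega>. R \<omega>})"
      by (intro B.finite_measure_mono sets.Un test_decision_law[OF test] sets_G_law[OF EG] sets_G_law[OF R])
    also have "\<dots> \<le> measure (law B) (?D i \<union> (?E j \<inter> {\<omega> \<in> \<Omega>. \<not> R \<omega>})) + measure (law B) {\<omega> \<in> \<Omega>. R \<omega>}"
      by (intro measure_Un_le sets.Un test_decision_law[OF test] sets_G_law[OF EG] sets_G_law[OF R])
    also have "measure (law B) (?D i \<union> (?E j \<inter> {\<omega> \<in> \<Omega>. \<not> R \<omega>}))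
        \<le> measure (law B) (?D i) + measure (law B) (?E j \<inter> {\<omega> \<in> \<Omega>. \<not> R \<omega>})"
      by (intro measure_Un_le test_decision_law[OF test] sets_G_law[OF EG])
    also note le
    also have "measure (law C) (?E j \<inter> {\<omega> \<in> \<Omega>. \<not> R \<omega>}) \<le> measure (law C) (?D j)"
      by (rule C.finite_measure_mono) (use test_decision_law[OF test] in auto)
    finally show ?thesis by simp
  qed
  have m1: "{\<omega> \<in> \<Omega>. x < - ZA A n \<omega>} \<in> sets (G n)"
    using borel_measurable_less[of "\<lambda>_. x" "G n" "\<lambda>\<omega>. - ZA A n \<omega>"] measurable_ZA[of A n] by simp
  have m2: "{\<omega> \<in> \<Omega>. x < ZA A n \<omega>} \<in> sets (G n)"
    using borel_measurable_less[of "\<lambda>_. x" "G n" "ZA A n"] measurable_ZA[of A n] by simp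
  have EG: "?E j \<inter> {\<omega> \<in> \<Omega>. \<not> R \<omega>} \<in> sets (G n)" if "{\<omega> \<in> \<Omega>. R \<omega>} \<in> sets (G n)" for j R
    by (rule sets.Int[OF test_decision_event[OF test] neg[OF that]])
  show ?null
    using split[of 1 0 "\<lambda>\<omega>. x < - ZA A n \<omega>" "{}" A] m1 null_le_exp_law[OF A n EG[OF m1, of 0], of x]
    by force
  show ?signal
    using split[of 0 1 "\<lambda>\<omega>. x < ZA A n \<omega>" A "{}"] m2 law_le_exp_null[OF A n EG[OF m2, of 1], of x]
    by force
qed

end

section \<open>Error probabilities of the G-SLRT\<close>

text \<open>Used to sum the changes of measure over the possible stopping times.\<close>

lemma measure_UN_le_mult:
  assumes P: "finite_measure P" and Q: "finite_measure Q"
    and E: "disjoint_family E" "range E \<subseteq> sets P" "range E \<subseteq> sets Q"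
    and le: "\<And>s :: nat. measure P (E s) \<le> c * measure Q (E s)"
  shows "measure P (\<Union>s. E s) \<le> c * measure Q (\<Union>s. E s)"
proof -
  have "(\<lambda>s. measure P (E s)) sums measure P (\<Union>s. E s)"
    by (rule finite_measure.finite_measure_UNION[OF P E(2,1)])
  moreover have "(\<lambda>s. c * measure Q (E s)) sums (c * measure Q (\<Union>s. E s))"
    by (rule sums_mult[OF finite_measure.finite_measure_UNION[OF Q E(3,1)]])
  ultimately show ?thesis by (rule sums_le[rotated]) (rule le)
qed

locale channel_family = channels +
  fixes \<A> :: "nat set set"
  assumes family_nonempty: "\<A> \<noteq> {}"
    and family_subsets: "\<And>A. A \<in> \<A> \<Longrightarrow> A \<noteq> {} \<and> A \<subseteq> {1..K}"
begin

lemma finite_family: "finite \<A>"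
  by (rule finite_subset[of _ "Pow {1..K}"]) (use family_subsets in auto)

lemma card_family: "1 \<le> card \<A>"
  using finite_family family_nonempty by (simp add: Suc_le_eq card_gt_0_iff)

abbreviation mx :: "nat \<Rightarrow> (nat \<Rightarrow> nat \<Rightarrow> 'a) \<Rightarrow> real" where
  "mx t \<equiv> max_llr K S P0 P1 \<A> t"

lemma measurable_mx:
  assumes "t \<le> u" shows "mx t \<in> borel_measurable (G u)"
proof -
  have "mx t \<in> borel_measurable (G t)"
    unfolding max_llr_def[abs_def] by (rule borel_measurable_Max[OF finite_family]) measurable
  moreover have "subalgebra (G u) (G t)"
    using filtration.sets_F_mono[OF filtration_global, of "enat t" "enat u"] assms by (simp add: subalgebra_def)
  ultimately show ?thesis by (rule measurable_from_subalg[rotated])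
qed

lemma le_mx: "A \<in> \<A> \<Longrightarrow> ZA A t \<omega> \<le> mx t \<omega>"
  unfolding max_llr_def using finite_family by (intro Max_ge) auto

lemma mx_attained: "\<exists>A\<in>\<A>. mx t \<omega> = ZA A t \<omega>"
proof -
  have "mx t \<omega> \<in> (\<lambda>A. ZA A t \<omega>) ` \<A>"
    unfolding max_llr_def using finite_family family_nonempty by (intro Max_in) auto
  then show ?thesis by auto
qed

context
  fixes a b :: real
begin

abbreviation T :: "(nat \<Rightarrow> nat \<Rightarrow> 'a) \<Rightarrow> enat" where
  "T \<equiv> gslrt_time K S P0 P1 \<A> a b"

abbreviation D :: "(nat \<Rightarrow> nat \<Rightarrow> 'a) \<Rightarrow> nat option" where
  "D \<equiv> gslrt_decision K S P0 P1 \<A> a b"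

lemma gslrt_time_le: "1 \<le> t \<Longrightarrow> mx t \<omega> \<notin> {-a<..<b} \<Longrightarrow> T \<omega> \<le> enat t"
  unfolding gslrt_time_def by (rule Inf_lower) auto

lemma gslrt_time_attained: "T \<omega> = enat t \<Longrightarrow> 1 \<le> t \<and> mx t \<omega> \<notin> {-a<..<b}"
proof -
  let ?X = "enat ` {t. 1 \<le> t \<and> mx t \<omega> \<notin> {-a<..<b}}"
  assume T: "T \<omega> = enat t"
  have "?X \<noteq> {}"
    using T by (auto simp: gslrt_time_def Inf_enat_def split: if_splits)
  then have "T \<omega> \<in> ?X"
    unfolding gslrt_time_def Inf_enat_def using LeastI_ex[of "\<lambda>x. x \<in> ?X"] by auto
  then show ?thesis using T by auto
qed

lemma gslrt_time_ge_1: "1 \<le> T \<omega>"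
proof (cases "T \<omega>")
  case (enat t)
  then show ?thesis using gslrt_time_attained[OF enat] by (simp add: one_enat_def)
qed simp

text \<open>The event that the G-SLRT stops at \<open>t\<close> in terms of finitely many statistics; its measurability at
time \<open>t\<close> follows.\<close>

lemma gslrt_time_eq_iff:
  "T \<omega> = enat t \<longleftrightarrow> 1 \<le> t \<and> mx t \<omega> \<notin> {-a<..<b} \<and> (\<forall>s\<in>{1..<t}. mx s \<omega> \<in> {-a<..<b})"
proof
  assume T: "T \<omega> = enat t"
  then show "1 \<le> t \<and> mx t \<omega> \<notin> {-a<..<b} \<and> (\<forall>s\<in>{1..<t}. mx s \<omega> \<in> {-a<..<b})"
    using gslrt_time_attained[OF T] gslrt_time_le[of _ \<omega>] by (metis T atLeastLessThan_iff enat_ord_simps(1) not_le)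
next
  assume *: "1 \<le> t \<and> mx t \<omega> \<notin> {-a<..<b} \<and> (\<forall>s\<in>{1..<t}. mx s \<omega> \<in> {-a<..<b})"
  then have "T \<omega> \<le> enat t" by (intro gslrt_time_le) auto
  then obtain s where s: "T \<omega> = enat s" "s \<le> t" by (cases "T \<omega>") auto
  have "s = t"
    using gslrt_time_attained[OF s(1)] s(2) * by (metis atLeastLessThan_iff le_neq_implies_less)
  then show "T \<omega> = enat t" using s by simp
qed

lemma gslrt_decision_enat: "T \<omega> = enat t \<Longrightarrow> D \<omega> = (if b \<le> mx t \<omega> then Some 1 else Some 0)"
  by (simp add: gslrt_decision_def)

lemma gslrt_decision_infinity: "T \<omega> = \<infinity> \<Longrightarrow> D \<omega> = None"
  by (simp add: gslrt_decision_def)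

lemma pred_gslrt_time_eq:
  assumes "t \<le> u" shows "Measurable.pred (G u) (\<lambda>\<omega>. T \<omega> = enat t)"
proof -
  have [measurable]: "mx t \<in> borel_measurable (G u)" by (rule measurable_mx[OF assms])
  have "Measurable.pred (G u) (\<lambda>\<omega>. \<forall>s\<in>{1..<t}. mx s \<omega> \<in> {-a<..<b})"
  proof (rule pred_intros_finite)
    show "Measurable.pred (G u) (\<lambda>\<omega>. mx s \<omega> \<in> {-a<..<b})" if "s \<in> {1..<t}" for s
    proof -
      have [measurable]: "mx s \<in> borel_measurable (G u)" using assms that by (intro measurable_mx) auto
      show ?thesis by measurable
    qed
  qed simp
  then show ?thesis unfolding gslrt_time_eq_iff by measurable
qed

lemma sequential_test_gslrt: "sequential_test K S (T, D)"
proof -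
  let ?F = "global_filtration K S"
  interpret filtration \<Omega> ?F by (rule filtration_global)
  have predT: "Measurable.pred (?F t) (\<lambda>\<omega>. T \<omega> = enat s)" if "enat s \<le> t" for s t
  proof -
    have "subalgebra (?F t) (?F (enat s))"
      using sets_F_mono[OF that] by (simp add: subalgebra_def)
    then show ?thesis by (rule measurable_from_subalg) (rule pred_gslrt_time_eq[OF order_refl])
  qed
  have predM: "Measurable.pred (?F t) (\<lambda>\<omega>. b \<le> mx s \<omega>)" if "enat s \<le> t" for s t
  proof -
    have "subalgebra (?F t) (?F (enat s))"
      using sets_F_mono[OF that] by (simp add: subalgebra_def)
    moreover have "Measurable.pred (?F (enat s)) (\<lambda>\<omega>. b \<le> mx s \<omega>)"
      using measurable_mx[OF order_refl, of s] by measurable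
    ultimately show ?thesis by (rule measurable_from_subalg)
  qed
  have st: "stopping_time ?F T"
  proof
    fix t
    have eq: "(\<lambda>\<omega>. T \<omega> \<le> t) = (\<lambda>\<omega>. t = \<infinity> \<or> (\<exists>s. enat s \<le> t \<and> T \<omega> = enat s))"
    proof
      fix \<omega> show "T \<omega> \<le> t \<longleftrightarrow> t = \<infinity> \<or> (\<exists>s. enat s \<le> t \<and> T \<omega> = enat s)"
        by (cases "T \<omega>") auto
    qed
    have "Measurable.pred (?F t) (\<lambda>\<omega>. t = \<infinity> \<or> (\<exists>s. enat s \<le> t \<and> T \<omega> = enat s))"
    proof (cases t)
      case (enat n)
      have "Measurable.pred (?F t) (\<lambda>\<omega>. enat s \<le> t \<and> T \<omega> = enat s)" for s
        using predT[of s t] by (cases "enat s \<le> t") simp_all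
      then have "Measurable.pred (?F t) (\<lambda>\<omega>. \<exists>s. enat s \<le> t \<and> T \<omega> = enat s)"
        by (rule pred_intros_countable)
      moreover have "t \<noteq> \<infinity>" by (simp add: enat)
      ultimately show ?thesis by (simp only: simp_thms)
    next
      case infinity
      then show ?thesis by (simp only: simp_thms) (rule measurable_const, simp)
    qed
    then show "Measurable.pred (?F t) (\<lambda>\<omega>. T \<omega> \<le> t)" unfolding eq .
  qed
  have dm: "D \<in> measurable (pre_sigma T) (count_space UNIV)"
  proof -
    have "Measurable.pred (pre_sigma T) (\<lambda>\<omega>. D \<omega> = v)" for v
    proof (rule pred_pre_sigmaI[OF st])
      fix t
      have eq: "(\<lambda>\<omega>. D \<omega> = v \<and> T \<omega> \<le> t) = (\<lambda>\<omega>. (\<exists>s. enat s \<le> t \<and> T \<omega> = enat s \<and>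
          (b \<le> mx s \<omega> \<and> v = Some 1 \<or> \<not> b \<le> mx s \<omega> \<and> v = Some 0)) \<or>
          (t = \<infinity> \<and> v = None \<and> (\<forall>s. T \<omega> \<noteq> enat s)))"
      proof
        fix \<omega>
        show "(D \<omega> = v \<and> T \<omega> \<le> t) = ((\<exists>s. enat s \<le> t \<and> T \<omega> = enat s \<and>
          (b \<le> mx s \<omega> \<and> v = Some 1 \<or> \<not> b \<le> mx s \<omega> \<and> v = Some 0)) \<or>
          (t = \<infinity> \<and> v = None \<and> (\<forall>s. T \<omega> \<noteq> enat s)))"
        proof (cases "T \<omega>")
          case (enat s)
          show ?thesis unfolding gslrt_decision_enat[OF enat] by (cases "b \<le> mx s \<omega>") (auto simp: enat)
        next
          case infinity
          show ?thesis unfolding gslrt_decision_infinity[OF infinity] by (auto simp: infinity)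
        qed
      qed
      have "Measurable.pred (?F t) (\<lambda>\<omega>. (\<exists>s. enat s \<le> t \<and> T \<omega> = enat s \<and>
          (b \<le> mx s \<omega> \<and> v = Some 1 \<or> \<not> b \<le> mx s \<omega> \<and> v = Some 0)) \<or>
          (t = \<infinity> \<and> v = None \<and> (\<forall>s. T \<omega> \<noteq> enat s)))"
      proof (rule pred_intros_logic(5))
        show "Measurable.pred (?F t) (\<lambda>\<omega>. \<exists>s. enat s \<le> t \<and> T \<omega> = enat s \<and>
          (b \<le> mx s \<omega> \<and> v = Some 1 \<or> \<not> b \<le> mx s \<omega> \<and> v = Some 0))"
        proof (rule pred_intros_countable)
          fix s
          show "Measurable.pred (?F t) (\<lambda>\<omega>. enat s \<le> t \<and> T \<omega> = enat s \<and>
            (b \<le> mx s \<omega> \<and> v = Some 1 \<or> \<not> b \<le> mx s \<omega> \<and> v = Some 0))"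
          proof (cases "enat s \<le> t")
            case True
            note [measurable] = predT[OF True] predM[OF True]
            show ?thesis by measurable
          qed simp
        qed
        show "Measurable.pred (?F t) (\<lambda>\<omega>. t = \<infinity> \<and> v = None \<and> (\<forall>s. T \<omega> \<noteq> enat s))"
        proof (cases t)
          case infinity
          have [measurable]: "Measurable.pred (?F t) (\<lambda>\<omega>. T \<omega> = enat s)" for s
            by (rule predT) (simp add: infinity)
          show ?thesis by measurable
        qed simp
      qed
      then show "Measurable.pred (?F t) (\<lambda>\<omega>. D \<omega> = v \<and> T \<omega> \<le> t)" unfolding eq .
    qed
    then have "D -` {v} \<inter> space (pre_sigma T) \<in> sets (pre_sigma T)" for v
      by (simp add: pred_def vimage_def Int_def conj_commute)
    then show ?thesis
      by (subst measurable_count_space_eq_countable) auto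
  qed
  have dec: "if T \<omega> < \<infinity> then D \<omega> \<in> {Some 0, Some 1} else D \<omega> = None" for \<omega>
    using gslrt_decision_enat[of \<omega>] gslrt_decision_infinity[of \<omega>] by (cases "T \<omega>") auto
  show ?thesis
    unfolding sequential_test_def Let_def prod.case space_G
    by (intro conjI ballI st dm dec gslrt_time_ge_1)
qed

text \<open>When the null is rejected at time \<open>s\<close>, some \<open>A\<close> attains the maximum and has \<open>Z\<^sup>A\<^sub>s \<ge> b\<close>. On that event the null law
is at most \<open>exp (- b)\<close> times \<open>P\<^sup>A\<close>; the union over \<open>A\<close> costs the factor \<open>card \<A>\<close>.\<close>

lemma gslrt_first_error:
  shows "\<P>(\<omega> in law {}. D \<omega> = Some 1) \<le> real (card \<A>) * exp (- b)"
proof -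
  interpret N: prob_space "law {}" by (rule prob_law)
  define E where "E A s = {\<omega> \<in> \<Omega>. T \<omega> = enat s \<and> b \<le> ZA A s \<omega>}" for A s
  have EG: "E A s \<in> sets (G s)" for A s
  proof -
    note [measurable] = pred_gslrt_time_eq[OF order_refl, of s]
    have "Measurable.pred (G s) (\<lambda>\<omega>. T \<omega> = enat s \<and> b \<le> ZA A s \<omega>)" by measurable
    then show ?thesis by (simp add: pred_def E_def)
  qed
  have EL: "E A s \<in> sets (law B)" for A s B by (rule sets_G_law[OF EG])
  have EU: "(\<Union>s. E A s) \<in> sets (law B)" for A B
    by (rule sets.countable_UN) (use EL in auto)
  have each: "measure (law {}) (\<Union>s. E A s) \<le> exp (- b)" if A: "A \<in> \<A>" for A
  proof -
    interpret Q: prob_space "law A" by (rule prob_law)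
    have "measure (law {}) (\<Union>s. E A s) \<le> exp (- b) * measure (law A) (\<Union>s. E A s)"
    proof (rule measure_UN_le_mult[OF N.finite_measure_axioms Q.finite_measure_axioms])
      show "disjoint_family (E A)" by (auto simp: disjoint_family_on_def E_def)
      show "range (E A) \<subseteq> sets (law {})" "range (E A) \<subseteq> sets (law A)" using EL by auto
      fix s
      show "measure (law {}) (E A s) \<le> exp (- b) * measure (law A) (E A s)"
      proof (cases "s = 0")
        case True
        then have "E A s = {}" using gslrt_time_attained by (fastforce simp: E_def)
        then show ?thesis by simp
      next
        case False
        then show ?thesis using family_subsets[OF A]
          by (intro null_le_exp_law[of A s] EG) (auto simp: E_def)
      qed
    qed
    also have "\<dots> \<le> exp (- b) * 1" by (intro mult_left_mono) auto
    finally show ?thesis by simp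
  qed
  have "{\<omega> \<in> \<Omega>. D \<omega> = Some 1} \<subseteq> (\<Union>A\<in>\<A>. \<Union>s. E A s)"
  proof
    fix \<omega> assume w: "\<omega> \<in> {\<omega> \<in> \<Omega>. D \<omega> = Some 1}"
    then obtain s where s: "T \<omega> = enat s" using gslrt_decision_infinity[of \<omega>] by (cases "T \<omega>") auto
    then have "b \<le> mx s \<omega>" using w gslrt_decision_enat[OF s] by (auto split: if_splits)
    then show "\<omega> \<in> (\<Union>A\<in>\<A>. \<Union>s. E A s)" using w s mx_attained[of s \<omega>] by (auto simp: E_def)
  qed
  then have "measure (law {}) {\<omega> \<in> \<Omega>. D \<omega> = Some 1} \<le> measure (law {}) (\<Union>A\<in>\<A>. \<Union>s. E A s)"
    by (rule N.finite_measure_mono) (rule sets.finite_UN[OF finite_family EU])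
  also have "\<dots> \<le> (\<Sum>A\<in>\<A>. measure (law {}) (\<Union>s. E A s))"
    by (rule measure_UNION_le[OF finite_family EU])
  also have "\<dots> \<le> (\<Sum>A\<in>\<A>. exp (- b))" by (rule sum_mono) (rule each)
  finally show ?thesis by simp
qed

text \<open>When the null is accepted at time \<open>s\<close>, all \<open>Z\<^sup>A\<^sub>s\<close> are at most \<open>- a\<close>, so the change of measure applies to each \<open>A\<close> on
the whole event.\<close>

lemma gslrt_second_error:
  assumes A: "A \<in> \<A>"
  shows "\<P>(\<omega> in law A. D \<omega> = Some 0) \<le> exp (- a)"
proof -
  interpret N: prob_space "law {}" by (rule prob_law)
  interpret Q: prob_space "law A" by (rule prob_law)
  define E where "E s = {\<omega> \<in> \<Omega>. T \<omega> = enat s \<and> \<not> b \<le> mx s \<omega>}" for s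
  have EG: "E s \<in> sets (G s)" for s
  proof -
    note [measurable] = pred_gslrt_time_eq[OF order_refl, of s] measurable_mx[OF order_refl, of s]
    have "Measurable.pred (G s) (\<lambda>\<omega>. T \<omega> = enat s \<and> \<not> b \<le> mx s \<omega>)" by measurable
    then show ?thesis by (simp add: pred_def E_def)
  qed
  have EL: "E s \<in> sets (law B)" for s B by (rule sets_G_law[OF EG])
  have "{\<omega> \<in> \<Omega>. D \<omega> = Some 0} = (\<Union>s. E s)"
  proof (rule set_eqI)
    fix \<omega> show "\<omega> \<in> {\<omega> \<in> \<Omega>. D \<omega> = Some 0} \<longleftrightarrow> \<omega> \<in> (\<Union>s. E s)"
      using gslrt_decision_infinity[of \<omega>] gslrt_decision_enat[of \<omega>]
      by (cases "T \<omega>") (auto simp: E_def)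
  qed
  then have "\<P>(\<omega> in law A. D \<omega> = Some 0) = measure (law A) (\<Union>s. E s)" by simp
  also have "\<dots> \<le> exp (- a) * measure (law {}) (\<Union>s. E s)"
  proof (rule measure_UN_le_mult[OF Q.finite_measure_axioms N.finite_measure_axioms])
    show "disjoint_family E" by (auto simp: disjoint_family_on_def E_def)
    show "range E \<subseteq> sets (law {})" "range E \<subseteq> sets (law A)" using EL by auto
    fix s
    show "measure (law A) (E s) \<le> exp (- a) * measure (law {}) (E s)"
    proof (cases "s = 0")
      case True
      then have "E s = {}" using gslrt_time_attained by (fastforce simp: E_def)
      then show ?thesis by simp
    next
      case False
      have le: "ZA A s \<omega> \<le> - a" if "\<omega> \<in> E s" for \<omega>
        using that gslrt_time_attained[of \<omega> s] le_mx[OF A, of s \<omega>] by (auto simp: E_def)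
      show ?thesis using family_subsets[OF A] False
        by (intro law_le_exp_null[of A s] EG le) auto
    qed
  qed
  also have "\<dots> \<le> exp (- a) * 1" by (intro mult_left_mono) auto
  finally show ?thesis by simp
qed

end

lemma gslrt_in_error_class:
  assumes \<alpha>: "0 < \<alpha>" "\<alpha> < 1" and \<beta>: "0 < \<beta>" "\<beta> < 1"
  shows "gslrt K S P0 P1 \<A> \<bar>ln \<beta>\<bar> \<bar>ln (\<alpha> / real (card \<A>))\<bar> \<in> error_class K S P0 P1 \<A> \<alpha> \<beta>"
proof -
  let ?n = "real (card \<A>)"
  have n: "1 \<le> ?n" using card_family by simp
  have "\<alpha> / ?n < 1" using n \<alpha> by (simp add: divide_less_eq)
  then have b: "exp (- \<bar>ln (\<alpha> / ?n)\<bar>) = \<alpha> / ?n" using \<alpha> n by simp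
  have a: "exp (- \<bar>ln \<beta>\<bar>) = \<beta>" using \<beta> by simp
  show ?thesis
    unfolding gslrt_def error_class_def
    using sequential_test_gslrt gslrt_first_error[of "\<bar>ln \<beta>\<bar>" "\<bar>ln (\<alpha> / ?n)\<bar>"]
      gslrt_second_error[of _ "\<bar>ln \<beta>\<bar>" "\<bar>ln (\<alpha> / ?n)\<bar>"] finite_family family_nonempty n
    by (simp add: a b)
qed

end

section \<open>Asymptotic equivalence as both error bounds vanish\<close>

text \<open>The asymptotics in extended nonnegative reals reduce to the reals, since the bounds make \<open>f\<close>
eventually positive and finite.\<close>

lemma ratio_equiv_squeeze:
  fixes f :: "'p \<Rightarrow> ennreal" and g :: "'p \<Rightarrow> real"
  assumes g: "eventually (\<lambda>p. 0 < g p) F"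
    and upper: "\<And>\<rho>. 1 < \<rho> \<Longrightarrow> eventually (\<lambda>p. f p \<le> ennreal (\<rho> * g p)) F"
    and lower: "\<And>\<rho>. 0 < \<rho> \<Longrightarrow> \<rho> < 1 \<Longrightarrow> eventually (\<lambda>p. ennreal (\<rho> * g p) \<le> f p) F"
  shows "ratio_equiv F f (\<lambda>p. ennreal (g p))" and "ratio_equiv F (\<lambda>p. ennreal (g p)) f"
proof -
  define f' where "f' p = enn2real (f p)" for p
  have f: "eventually (\<lambda>p. f p = ennreal (f' p) \<and> 0 < f' p \<and> 0 < g p) F"
  proof -
    have "eventually (\<lambda>p. f p \<le> ennreal (2 * g p)) F" by (rule upper) simp
    moreover have "eventually (\<lambda>p. ennreal (1 / 2 * g p) \<le> f p) F" by (rule lower) simp_all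
    ultimately show ?thesis using g
    proof eventually_elim
      case (elim p)
      then have "f p < \<top>" by (auto intro: le_less_trans)
      then have eq: "f p = ennreal (f' p)" by (simp add: f'_def)
      have "ennreal (1 / 2 * g p) \<le> ennreal (f' p)" using elim eq by simp
      then have "1 / 2 * g p \<le> f' p" by (subst (asm) ennreal_le_iff) (simp_all add: f'_def)
      then show ?case using eq elim by auto
    qed
  qed
  have r: "((\<lambda>p. f' p / g p) \<longlongrightarrow> 1) F"
  proof (rule order_tendstoI)
    fix a :: real assume a: "a < 1"
    define \<rho> where "\<rho> = max (1 / 2) ((1 + a) / 2)"
    have "a < (1 + a) / 2" using a by simp
    then have \<rho>: "0 < \<rho>" "\<rho> < 1" "a < \<rho>" using a by (simp_all add: \<rho>_def less_max_iff_disj)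
    show "eventually (\<lambda>p. a < f' p / g p) F"
      using f lower[OF \<rho>(1,2)]
    proof eventually_elim
      case (elim p)
      then have "\<rho> * g p \<le> f' p" by simp
      then have "\<rho> \<le> f' p / g p" using elim by (simp add: pos_le_divide_eq)
      then show ?case using \<rho> by simp
    qed
  next
    fix a :: real assume a: "1 < a"
    define \<rho> where "\<rho> = (1 + a) / 2"
    have \<rho>: "1 < \<rho>" "\<rho> < a" using a by (auto simp: \<rho>_def)
    show "eventually (\<lambda>p. f' p / g p < a) F"
      using f upper[OF \<rho>(1)]
    proof eventually_elim
      case (elim p)
      then have "ennreal (f' p) \<le> ennreal (\<rho> * g p)" by simp
      then have "f' p \<le> \<rho> * g p" by (subst (asm) ennreal_le_iff) (use \<rho> elim in auto)
      then have "f' p / g p \<le> \<rho>" using elim by (simp add: pos_divide_le_eq)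
      then show ?case using \<rho> by simp
    qed
  qed
  have r': "((\<lambda>p. g p / f' p) \<longlongrightarrow> 1) F"
    using tendsto_inverse[OF r] by simp
  show "ratio_equiv F f (\<lambda>p. ennreal (g p))"
    unfolding ratio_equiv_def ennreal_1[symmetric]
    by (rule Lim_transform_eventually[OF tendsto_ennrealI[OF r]])
       (use f in \<open>eventually_elim, simp add: divide_ennreal\<close>)
  show "ratio_equiv F (\<lambda>p. ennreal (g p)) f"
    unfolding ratio_equiv_def ennreal_1[symmetric]
    by (rule Lim_transform_eventually[OF tendsto_ennrealI[OF r']])
       (use f in \<open>eventually_elim, simp add: divide_ennreal\<close>)
qed

lemma eventually_max_to_zeroI:
  assumes "0 < \<epsilon>"
    and "\<And>\<alpha> \<beta>. 0 < \<alpha> \<Longrightarrow> \<alpha> < 1 \<Longrightarrow> 0 < \<beta> \<Longrightarrow> \<beta> < 1 \<Longrightarrow> \<alpha> < \<epsilon> \<Longrightarrow> \<beta> < \<epsilon> \<Longrightarrow> P (\<alpha>, \<beta>)"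
  shows "eventually P max_to_zero"
proof -
  have "\<forall>\<^sub>F x in nhds (0 :: real). x < \<epsilon>"
    by (rule eventually_nhds_in_open[of "{..<\<epsilon>}", simplified]) fact
  then have "eventually (\<lambda>p. case p of (\<alpha>, \<beta>) \<Rightarrow> max \<alpha> \<beta> < \<epsilon>) (filtercomap (\<lambda>(\<alpha>, \<beta>). max \<alpha> \<beta>) (nhds (0 :: real)))"
    by (auto simp: eventually_filtercomap case_prod_beta)
  then show ?thesis
    unfolding max_to_zero_def eventually_inf_principal
    by eventually_elim (use assms(2) in auto)
qed

lemma ln_at_top_max_to_zero:
  "filterlim (\<lambda>(\<alpha>, \<beta>). \<bar>ln \<alpha>\<bar>) at_top max_to_zero"
  "filterlim (\<lambda>(\<alpha>, \<beta>). \<bar>ln \<beta>\<bar>) at_top max_to_zero"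
proof -
  have *: "c \<le> \<bar>ln x\<bar>" if "0 < x" "x < exp (- c)" for c x :: real
  proof -
    have "ln x < - c" using that by (metis exp_gt_zero ln_exp ln_less_cancel_iff)
    then show ?thesis by simp
  qed
  show "filterlim (\<lambda>(\<alpha>, \<beta>). \<bar>ln \<alpha>\<bar>) at_top max_to_zero"
    unfolding filterlim_at_top
  proof
    fix c show "\<forall>\<^sub>F p in max_to_zero. c \<le> (case p of (\<alpha>, \<beta>) \<Rightarrow> \<bar>ln \<alpha>\<bar>)"
      by (rule eventually_max_to_zeroI[of "exp (- c)"], simp, unfold prod.case, erule (1) *)
  qed
  show "filterlim (\<lambda>(\<alpha>, \<beta>). \<bar>ln \<beta>\<bar>) at_top max_to_zero"
    unfolding filterlim_at_top
  proof
    fix c show "\<forall>\<^sub>F p in max_to_zero. c \<le> (case p of (\<alpha>, \<beta>) \<Rightarrow> \<bar>ln \<beta>\<bar>)"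
      by (rule eventually_max_to_zeroI[of "exp (- c)"], simp, unfold prod.case, erule (1) *)
  qed
qed

section \<open>Expected sample sizes in the multichannel problem\<close>

context channels_indep
begin

text \<open>The independence needed for first passage times. The sign \<open>\<sigma>\<close> allows for both directions: \<open>- 1\<close> under the
null law and \<open>1\<close> under \<open>law A\<close>.\<close>

lemma indep_signed_sums:
  assumes \<B>: "finite \<B>" "\<And>B. B \<in> \<B> \<Longrightarrow> B \<subseteq> {1..K}" and t: "1 \<le> t"
  shows "\<P>(\<omega> in law A. (\<forall>s\<in>{1..t}. \<exists>B\<in>\<B>. \<sigma> * (\<Sum>k\<in>B. Z k s \<omega>) < b) \<and>
        (\<exists>B\<in>\<B>. \<sigma> * (\<Sum>k\<in>B. Z k (2 * t) \<omega>) - \<sigma> * (\<Sum>k\<in>B. Z k t \<omega>) < c))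
    = \<P>(\<omega> in law A. \<forall>s\<in>{1..t}. \<exists>B\<in>\<B>. \<sigma> * (\<Sum>k\<in>B. Z k s \<omega>) < b) *
      \<P>(\<omega> in law A. \<exists>B\<in>\<B>. \<sigma> * (\<Sum>k\<in>B. Z k (2 * t) \<omega>) - \<sigma> * (\<Sum>k\<in>B. Z k t \<omega>) < c)"
proof -
  define \<Phi> where "\<Phi> z \<longleftrightarrow> (\<forall>s\<in>{1..t}. \<exists>B\<in>\<B>. \<sigma> * (\<Sum>k\<in>B. z (k, s)) < b)" for z :: "nat \<times> nat \<Rightarrow> real"
  define \<Psi> where "\<Psi> y \<longleftrightarrow> (\<exists>B\<in>\<B>. \<sigma> * (\<Sum>k\<in>B. y k) < c)" for y :: "nat \<Rightarrow> real"
  have m\<Phi>: "Measurable.pred (PiM ({1..K} \<times> {1..t}) (\<lambda>_. borel)) \<Phi>"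
    unfolding \<Phi>_def
  proof (intro pred_intros_finite \<B>(1) finite_atLeastAtMost)
    fix s B assume "s \<in> {1..t}" "B \<in> \<B>"
    then have "(\<lambda>z. z (k, s)) \<in> borel_measurable (PiM ({1..K} \<times> {1..t}) (\<lambda>_. borel :: real measure))" if "k \<in> B" for k
      using \<B>(2)[of B] that by (intro measurable_component_singleton) auto
    then have "(\<lambda>z. \<Sum>k\<in>B. z (k, s)) \<in> borel_measurable (PiM ({1..K} \<times> {1..t}) (\<lambda>_. borel :: real measure))"
      by (rule borel_measurable_sum)
    then show "Measurable.pred (PiM ({1..K} \<times> {1..t}) (\<lambda>_. borel)) (\<lambda>z. \<sigma> * (\<Sum>k\<in>B. z (k, s)) < b)"
      by measurable
  qed
  have m\<Psi>: "Measurable.pred (PiM {1..K} (\<lambda>_. borel)) \<Psi>"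
    unfolding \<Psi>_def
  proof (intro pred_intros_finite \<B>(1))
    fix B assume "B \<in> \<B>"
    then have "(\<lambda>y. y k) \<in> borel_measurable (PiM {1..K} (\<lambda>_. borel :: real measure))" if "k \<in> B" for k
      using \<B>(2)[of B] that by (intro measurable_component_singleton) auto
    then have "(\<lambda>y. \<Sum>k\<in>B. y k) \<in> borel_measurable (PiM {1..K} (\<lambda>_. borel :: real measure))"
      by (rule borel_measurable_sum)
    then show "Measurable.pred (PiM {1..K} (\<lambda>_. borel)) (\<lambda>y. \<sigma> * (\<Sum>k\<in>B. y k) < c)"
      by measurable
  qed
  have e1: "(\<Sum>k\<in>B. (\<lambda>(k, s)\<in>{1..K} \<times> {1..t}. Z k s \<omega>) (k, s)) = (\<Sum>k\<in>B. Z k s \<omega>)"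
    if "B \<in> \<B>" "s \<in> {1..t}" for B s \<omega>
    by (rule sum.cong) (use that \<B>(2)[of B] in auto)
  have e2: "(\<Sum>k\<in>B. (\<lambda>k\<in>{1..K}. Z k (2 * t) \<omega> - Z k t \<omega>) k) = (\<Sum>k\<in>B. Z k (2 * t) \<omega>) - (\<Sum>k\<in>B. Z k t \<omega>)"
    if "B \<in> \<B>" for B \<omega>
    unfolding sum_subtractf[symmetric] by (rule sum.cong) (use that \<B>(2)[of B] in auto)
  have \<Phi>: "\<Phi> (\<lambda>(k, s)\<in>{1..K} \<times> {1..t}. Z k s \<omega>) \<longleftrightarrow> (\<forall>s\<in>{1..t}. \<exists>B\<in>\<B>. \<sigma> * (\<Sum>k\<in>B. Z k s \<omega>) < b)" for \<omega>
    unfolding \<Phi>_def by (intro ball_cong bex_cong refl) (simp only: e1)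
  have \<Psi>: "\<Psi> (\<lambda>k\<in>{1..K}. Z k (2 * t) \<omega> - Z k t \<omega>) \<longleftrightarrow>
      (\<exists>B\<in>\<B>. \<sigma> * (\<Sum>k\<in>B. Z k (2 * t) \<omega>) - \<sigma> * (\<Sum>k\<in>B. Z k t \<omega>) < c)" for \<omega>
    unfolding \<Psi>_def by (intro bex_cong refl) (simp only: e2 right_diff_distrib)
  have "t \<le> 2 * t" by simp
  from indep_past_future[OF m\<Phi> m\<Psi> t this, of A] show ?thesis unfolding \<Phi> \<Psi> .
qed

end

locale multichannel = channels_indep + channel_family +
  fixes I0 I1 :: "nat \<Rightarrow> real"
  assumes I0_pos: "\<And>k. k \<in> {1..K} \<Longrightarrow> 0 < I0 k"
    and I1_pos: "\<And>k. k \<in> {1..K} \<Longrightarrow> 0 < I1 k"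
    and lln1: "\<And>k. k \<in> {1..K} \<Longrightarrow>
      AE x in P1 k. (\<lambda>t. local_llr (S k) (P0 k) (P1 k) t x / real t) \<longlonglongrightarrow> I1 k"
    and lln0: "\<And>k. k \<in> {1..K} \<Longrightarrow>
      AE x in P0 k. (\<lambda>t. local_llr (S k) (P0 k) (P1 k) t x / real t) \<longlonglongrightarrow> - I0 k"
begin

lemma AE_law_component:
  assumes "k \<in> {1..K}" "AE x in chan A k. P x"
  shows "AE \<omega> in law A. P (\<omega> k)"
  unfolding joint_law_def
  using AE_PiM_component[of "{1..K}" "chan A" k P] prob_chan assms by simp

lemma lln_Z:
  assumes B: "B \<subseteq> {1..K}"
    and lim: "\<And>k. k \<in> B \<Longrightarrow> AE \<omega> in law A. (\<lambda>t. Z k t \<omega> / real t) \<longlonglongrightarrow> i k"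
  shows "AE \<omega> in law A. (\<lambda>t. (\<Sum>k\<in>B. Z k t \<omega>) / real t) \<longlonglongrightarrow> (\<Sum>k\<in>B. i k)"
proof -
  have "finite B" using B by (rule finite_subset) simp
  then have "AE \<omega> in law A. \<forall>k\<in>B. (\<lambda>t. Z k t \<omega> / real t) \<longlonglongrightarrow> i k"
    using lim by (simp add: AE_finite_all)
  then show ?thesis
    by eventually_elim (auto simp: sum_divide_distrib intro: tendsto_sum)
qed

lemma lln_null:
  assumes B: "B \<subseteq> {1..K}"
  shows "AE \<omega> in law {}. (\<lambda>t. (\<Sum>k\<in>B. Z k t \<omega>) / real t) \<longlonglongrightarrow> - (\<Sum>k\<in>B. I0 k)"
  unfolding sum_negf[symmetric]
proof (rule lln_Z[OF B])
  fix k assume "k \<in> B"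
  then have k: "k \<in> {1..K}" using B by blast
  show "AE \<omega> in law {}. (\<lambda>t. Z k t \<omega> / real t) \<longlonglongrightarrow> - I0 k"
    unfolding Z_def by (rule AE_law_component[OF k]) (use lln0[OF k] in simp)
qed

lemma lln_signal:
  assumes B: "B \<subseteq> {1..K}"
  shows "AE \<omega> in law B. (\<lambda>t. (\<Sum>k\<in>B. Z k t \<omega>) / real t) \<longlonglongrightarrow> (\<Sum>k\<in>B. I1 k)"
proof (rule lln_Z[OF B])
  fix k assume kB: "k \<in> B"
  then have k: "k \<in> {1..K}" using B by blast
  show "AE \<omega> in law B. (\<lambda>t. Z k t \<omega> / real t) \<longlonglongrightarrow> I1 k"
    unfolding Z_def by (rule AE_law_component[OF k]) (use lln1[OF k] kB in simp)
qed

lemma transfer_ZA: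
  assumes B: "B \<subseteq> {1..K}"
    and lim: "AE \<omega> in law C. (\<lambda>t. (\<Sum>k\<in>B. Z k t \<omega>) / real t) \<longlonglongrightarrow> l" and C: "C \<subseteq> {1..K}"
  shows "AE \<omega> in law C. (\<lambda>t. ZA B t \<omega> / real t) \<longlonglongrightarrow> l"
  using lim global_llr_eq_sum[OF B C]
proof eventually_elim
  case (elim \<omega>)
  have "\<forall>\<^sub>F t in sequentially. (\<Sum>k\<in>B. Z k t \<omega>) / real t = ZA B t \<omega> / real t"
    using eventually_ge_at_top[of 1] by eventually_elim (use elim in auto)
  then show ?case using elim(1) by (rule Lim_transform_eventually[rotated])
qed

definition J0 :: real where "J0 = (MIN A\<in>\<A>. \<Sum>k\<in>A. I0 k)"

definition J1 :: "nat set \<Rightarrow> real" where "J1 A = (\<Sum>k\<in>A. I1 k)"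

lemma sum_pos_family:
  assumes "A \<in> \<A>" "\<And>k. k \<in> {1..K} \<Longrightarrow> 0 < i k"
  shows "0 < (\<Sum>k\<in>A. i k :: real)"
proof (rule sum_pos)
  have A: "A \<noteq> {}" "A \<subseteq> {1..K}" using family_subsets[OF assms(1)] by blast+
  show "finite A" by (rule finite_subset[OF A(2)]) simp
  show "A \<noteq> {}" by (rule A(1))
  show "0 < i k" if "k \<in> A" for k by (rule assms(2)) (use that A(2) in blast)
qed

lemma J0_attained: "\<exists>A\<in>\<A>. J0 = (\<Sum>k\<in>A. I0 k)"
proof -
  have "J0 \<in> (\<lambda>A. \<Sum>k\<in>A. I0 k) ` \<A>"
    unfolding J0_def using finite_family family_nonempty by (intro Min_in) auto
  then show ?thesis by auto
qed

lemma J0_pos: "0 < J0"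
proof -
  obtain A where A: "A \<in> \<A>" "J0 = (\<Sum>k\<in>A. I0 k)" using J0_attained by blast
  show ?thesis unfolding A(2) by (rule sum_pos_family[OF A(1) I0_pos])
qed

lemma J1_pos: "A \<in> \<A> \<Longrightarrow> 0 < J1 A"
  unfolding J1_def by (rule sum_pos_family[OF _ I1_pos])

text \<open>The lower tail of \<open>- Z\<^sup>A\<close> is exponential since \<open>P\<^sub>0(Z\<^sup>A\<^sub>t > x) \<le> exp (- x) * P\<^sup>A(Z\<^sup>A\<^sub>t > x)\<close>.\<close>

lemma first_passage_null: "first_passage (law {}) (\<lambda>A t \<omega>. - 1 * (\<Sum>k\<in>A. Z k t \<omega>)) \<A> (\<lambda>A. \<Sum>k\<in>A. I0 k) J0"
proof -
  interpret prob_space "law {}" by (rule prob_law)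
  show ?thesis
  proof
    show "finite \<A>" by (rule finite_family)
    show "0 < J0" by (rule J0_pos)
    fix A assume A: "A \<in> \<A>"
    have AK: "A \<subseteq> {1..K}" using family_subsets[OF A] by simp
    show "J0 \<le> (\<Sum>k\<in>A. I0 k)" unfolding J0_def using finite_family A by (intro Min_le) auto
    show "(\<lambda>\<omega>. - 1 * (\<Sum>k\<in>A. Z k t \<omega>)) \<in> borel_measurable (law {})" for t
      using measurable_G_law[OF measurable_sum_Z[OF AK]] by measurable
    show "AE \<omega> in law {}. (\<lambda>t. - 1 * (\<Sum>k\<in>A. Z k t \<omega>) / real t) \<longlonglongrightarrow> (\<Sum>k\<in>A. I0 k)"
      using lln_null[OF AK] 
    proof eventually_elim
      case (elim \<omega>)
      from tendsto_minus[OF elim] show ?case by simp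
    qed
    fix t :: nat and x :: real assume t: "1 \<le> t"
    have E: "{\<omega> \<in> \<Omega>. x < (\<Sum>k\<in>A. Z k t \<omega>)} \<in> sets (G t)"
      using borel_measurable_less[of "\<lambda>_. x" "G t", OF _ measurable_sum_Z[OF AK, of t]] by simp
    have "measure (law {}) {\<omega> \<in> \<Omega>. x < (\<Sum>k\<in>A. Z k t \<omega>)}
        \<le> exp (- x) * measure (law A) {\<omega> \<in> \<Omega>. x < (\<Sum>k\<in>A. Z k t \<omega>)}"
      by (rule measure_le_exp_if_ge[OF prob_law prob_law subalgebra_law subalgebra_law
            measurable_sum_Z[OF AK] density_sum_Z[OF AK t] E]) auto
    also have "\<dots> \<le> exp (- x) * 1"
      by (intro mult_left_mono prob_space.prob_le_1 prob_law) auto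
    finally show "\<P>(\<omega> in law {}. - 1 * (\<Sum>k\<in>A. Z k t \<omega>) < - x) \<le> exp (- x)" by simp
  next
    fix t :: nat and b c :: real assume t: "1 \<le> t"
    show "\<P>(\<omega> in law {}. (\<forall>s\<in>{1..t}. \<exists>B\<in>\<A>. - 1 * (\<Sum>k\<in>B. Z k s \<omega>) < b) \<and>
        (\<exists>B\<in>\<A>. - 1 * (\<Sum>k\<in>B. Z k (2 * t) \<omega>) - - 1 * (\<Sum>k\<in>B. Z k t \<omega>) < c))
      = \<P>(\<omega> in law {}. \<forall>s\<in>{1..t}. \<exists>B\<in>\<A>. - 1 * (\<Sum>k\<in>B. Z k s \<omega>) < b) *
        \<P>(\<omega> in law {}. \<exists>B\<in>\<A>. - 1 * (\<Sum>k\<in>B. Z k (2 * t) \<omega>) - - 1 * (\<Sum>k\<in>B. Z k t \<omega>) < c)"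
      by (rule indep_signed_sums[OF finite_family _ t]) (use family_subsets in blast)
  qed
qed

text \<open>Under \<open>law A\<close> only the process of the true set \<open>A\<close> matters: once it has reached \<open>b\<close>, so has the maximum.\<close>

lemma first_passage_signal:
  assumes A: "A \<in> \<A>"
  shows "first_passage (law A) (\<lambda>A t \<omega>. 1 * (\<Sum>k\<in>A. Z k t \<omega>)) {A} J1 (J1 A)"
proof -
  interpret prob_space "law A" by (rule prob_law)
  have AK: "A \<subseteq> {1..K}" using family_subsets[OF A] by simp
  show ?thesis
  proof
    show "finite {A}" by simp
    show "0 < J1 A" by (rule J1_pos[OF A])
    fix B assume "B \<in> {A}"
    then have B: "B = A" by simp
    show "J1 A \<le> J1 B" by (simp add: B)
    show "(\<lambda>\<omega>. 1 * (\<Sum>k\<in>B. Z k t \<omega>)) \<in> borel_measurable (law A)" for t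
      using measurable_G_law[OF measurable_sum_Z[OF AK]] unfolding B by simp
    show "AE \<omega> in law A. (\<lambda>t. 1 * (\<Sum>k\<in>B. Z k t \<omega>) / real t) \<longlonglongrightarrow> J1 B"
      using lln_signal[OF AK] by (simp add: B J1_def)
    fix t :: nat and x :: real assume t: "1 \<le> t"
    have E: "{\<omega> \<in> \<Omega>. (\<Sum>k\<in>A. Z k t \<omega>) < - x} \<in> sets (G t)"
      using borel_measurable_less[of _ "G t" "\<lambda>_. - x", OF measurable_sum_Z[OF AK, of t]] by simp
    have "measure (law A) {\<omega> \<in> \<Omega>. (\<Sum>k\<in>A. Z k t \<omega>) < - x}
        \<le> exp (- x) * measure (law {}) {\<omega> \<in> \<Omega>. (\<Sum>k\<in>A. Z k t \<omega>) < - x}"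
      by (rule measure_le_exp_if_le[OF prob_law prob_law subalgebra_law subalgebra_law
            measurable_sum_Z[OF AK] density_sum_Z[OF AK t] E]) auto
    also have "\<dots> \<le> exp (- x) * 1"
      by (intro mult_left_mono prob_space.prob_le_1 prob_law) auto
    finally show "\<P>(\<omega> in law A. 1 * (\<Sum>k\<in>B. Z k t \<omega>) < - x) \<le> exp (- x)" by (simp add: B)
  next
    fix t :: nat and b c :: real assume t: "1 \<le> t"
    show "\<P>(\<omega> in law A. (\<forall>s\<in>{1..t}. \<exists>B\<in>{A}. 1 * (\<Sum>k\<in>B. Z k s \<omega>) < b) \<and>
        (\<exists>B\<in>{A}. 1 * (\<Sum>k\<in>B. Z k (2 * t) \<omega>) - 1 * (\<Sum>k\<in>B. Z k t \<omega>) < c))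
      = \<P>(\<omega> in law A. \<forall>s\<in>{1..t}. \<exists>B\<in>{A}. 1 * (\<Sum>k\<in>B. Z k s \<omega>) < b) *
        \<P>(\<omega> in law A. \<exists>B\<in>{A}. 1 * (\<Sum>k\<in>B. Z k (2 * t) \<omega>) - 1 * (\<Sum>k\<in>B. Z k t \<omega>) < c)"
      by (rule indep_signed_sums[OF _ _ t]) (use AK in blast)+
  qed
qed

lemma gslrt_time_null_upper:
  assumes "1 < \<rho>" "1 \<le> q"
  shows "\<forall>\<^sub>F a in at_top. \<forall>b. time_moment (law {}) q (gslrt_time K S P0 P1 \<A> a b) \<le> ennreal (\<rho> * (a / J0) ^ q)"
proof -
  interpret U: first_passage "law {}" "\<lambda>A t \<omega>. - 1 * (\<Sum>k\<in>A. Z k t \<omega>)" \<A> "\<lambda>A. \<Sum>k\<in>A. I0 k" J0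
    by (rule first_passage_null)
  have below: "AE \<omega> in law {}. \<forall>t. enat t < gslrt_time K S P0 P1 \<A> a b \<omega> \<longrightarrow> \<omega> \<in> U.below a t" for a b
  proof -
    have "AE \<omega> in law {}. \<forall>A\<in>\<A>. \<forall>t\<ge>1. ZA A t \<omega> = (\<Sum>k\<in>A. Z k t \<omega>)"
      using global_llr_eq_sum[of _ "{}"] family_subsets finite_family by (simp add: AE_finite_all)
    then show ?thesis
      using AE_space
    proof eventually_elim
      case (elim \<omega>)
      show ?case
      proof (intro allI impI)
        fix t assume t: "enat t < gslrt_time K S P0 P1 \<A> a b \<omega>"
        have "\<exists>A\<in>\<A>. - 1 * (\<Sum>k\<in>A. Z k s \<omega>) < a" if s: "s \<in> {1..t}" for s
        proof -
          have "mx s \<omega> \<in> {-a<..<b}"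
            using gslrt_time_le[of s \<omega> a b] s t by (cases "gslrt_time K S P0 P1 \<A> a b \<omega>") auto
          moreover obtain A where "A \<in> \<A>" "mx s \<omega> = ZA A s \<omega>" using mx_attained by blast
          ultimately show ?thesis using elim(1) s by (intro bexI[of _ A]) auto
        qed
        then show "\<omega> \<in> U.below a t" unfolding U.below_def using elim(2) by blast
      qed
    qed
  qed
  show ?thesis
    using U.moment_upper[OF assms]
  proof eventually_elim
    case (elim a)
    show ?case by (rule allI) (rule elim[THEN spec, THEN mp, OF below])
  qed
qed

lemma gslrt_time_signal_upper:
  assumes A: "A \<in> \<A>" and "1 < \<rho>" "1 \<le> q"
  shows "\<forall>\<^sub>F b in at_top. \<forall>a. time_moment (law A) q (gslrt_time K S P0 P1 \<A> a b) \<le> ennreal (\<rho> * (b / J1 A) ^ q)"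
proof -
  have AK: "A \<subseteq> {1..K}" using family_subsets[OF A] by simp
  interpret U: first_passage "law A" "\<lambda>A t \<omega>. 1 * (\<Sum>k\<in>A. Z k t \<omega>)" "{A}" J1 "J1 A"
    by (rule first_passage_signal[OF A])
  have below: "AE \<omega> in law A. \<forall>t. enat t < gslrt_time K S P0 P1 \<A> a b \<omega> \<longrightarrow> \<omega> \<in> U.below b t" for a b
    using global_llr_eq_sum[OF AK AK] AE_space
  proof eventually_elim
    case (elim \<omega>)
    show ?case
    proof (intro allI impI)
      fix t assume t: "enat t < gslrt_time K S P0 P1 \<A> a b \<omega>"
      have l: "\<exists>B\<in>{A}. 1 * (\<Sum>k\<in>B. Z k s \<omega>) < b" if s: "s \<in> {1..t}" for s
      proof -
        have "mx s \<omega> \<in> {-a<..<b}"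
          using gslrt_time_le[of s \<omega> a b] s t by (cases "gslrt_time K S P0 P1 \<A> a b \<omega>") auto
        then have "(\<Sum>k\<in>A. Z k s \<omega>) < b" using le_mx[OF A, of s \<omega>] elim(1) s by auto
        then show ?thesis by simp
      qed
      show "\<omega> \<in> U.below b t"
        unfolding U.below_def by (rule CollectI, rule conjI[OF elim(2)], rule ballI, rule l)
    qed
  qed
  show ?thesis
    using U.moment_upper[OF assms(2,3)]
  proof eventually_elim
    case (elim b)
    show ?case by (rule allI) (rule elim[THEN spec, THEN mp, OF below])
  qed
qed

end

context multichannel
begin

lemma eventually_unit: "\<forall>\<^sub>F p in max_to_zero. 0 < fst p \<and> fst p < 1 \<and> 0 < snd p \<and> snd p < (1 :: real)"
  by (rule eventually_max_to_zeroI[of 1]) auto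

lemma eventually_max_to_zero_le:
  assumes "0 < \<epsilon>"
  shows "\<forall>\<^sub>F p in max_to_zero. fst p \<le> \<epsilon> \<and> snd p \<le> (\<epsilon> :: real)"
  by (rule eventually_max_to_zeroI[OF assms]) auto

lemma eventually_ln_ge:
  "\<forall>\<^sub>F p in max_to_zero. c \<le> \<bar>ln (fst p)\<bar>" "\<forall>\<^sub>F p in max_to_zero. c \<le> \<bar>ln (snd p)\<bar>"
  using ln_at_top_max_to_zero unfolding filterlim_at_top case_prod_beta by blast+

text \<open>Here and below, \<open>p\<close> stands for \<open>(\<alpha>, \<beta>)\<close>.\<close>

abbreviation gslrt_test :: "real \<times> real \<Rightarrow> _" where
  "gslrt_test p \<equiv> gslrt K S P0 P1 \<A> \<bar>ln (snd p)\<bar> \<bar>ln (fst p / real (card \<A>))\<bar>"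

abbreviation optimum :: "(nat \<Rightarrow> nat \<Rightarrow> 'a) measure \<Rightarrow> nat \<Rightarrow> real \<times> real \<Rightarrow> ennreal" where
  "optimum M q p \<equiv> INF (\<tau>, d) \<in> error_class K S P0 P1 \<A> (fst p) (snd p). time_moment M q \<tau>"

lemma gslrt_null_upper:
  assumes "1 < \<rho>" "1 \<le> q"
  shows "\<forall>\<^sub>F p in max_to_zero. time_moment (law {}) q (fst (gslrt_test p)) \<le> ennreal (\<rho> * (\<bar>ln (snd p)\<bar> / J0) ^ q)"
proof -
  obtain c where c: "\<And>a b. c \<le> a \<Longrightarrow> time_moment (law {}) q (gslrt_time K S P0 P1 \<A> a b) \<le> ennreal (\<rho> * (a / J0) ^ q)"
    using gslrt_time_null_upper[OF assms] unfolding eventually_at_top_linorder by blast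
  from eventually_ln_ge(2)[of c] show ?thesis
    by eventually_elim (simp add: gslrt_def c)
qed

text \<open>The threshold is \<open>|log \<alpha>| + log (card \<A>)\<close>, asymptotically equivalent to \<open>|log \<alpha>|\<close>. As in \<open>moment_upper\<close>, the
factor \<open>\<rho> = s ^ (q + 1)\<close> absorbs the discrepancy in each of the \<open>q\<close> factors and the slack in the bound.\<close>

lemma gslrt_signal_upper:
  assumes A: "A \<in> \<A>" and \<rho>: "1 < \<rho>" and q: "1 \<le> q"
  shows "\<forall>\<^sub>F p in max_to_zero. time_moment (law A) q (fst (gslrt_test p)) \<le> ennreal (\<rho> * (\<bar>ln (fst p)\<bar> / J1 A) ^ q)"
proof -
  define s where "s = root (Suc q) \<rho>"
  have s: "1 < s" using \<rho> by (simp add: s_def)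
  have s_pow: "s ^ Suc q = \<rho>" unfolding s_def by (rule real_root_pow_pos2) (use \<rho> in auto)
  obtain c where c: "\<And>a b. c \<le> b \<Longrightarrow> time_moment (law A) q (gslrt_time K S P0 P1 \<A> a b) \<le> ennreal (s * (b / J1 A) ^ q)"
    using gslrt_time_signal_upper[OF A s q] unfolding eventually_at_top_linorder by blast
  let ?n = "real (card \<A>)"
  have n: "1 \<le> ?n" using card_family by simp
  from eventually_unit eventually_ln_ge(1)[of c] eventually_ln_ge(1)[of "ln ?n / (s - 1)"]
  show ?thesis
  proof eventually_elim
    case (elim p)
    let ?\<alpha> = "fst p" and ?b = "\<bar>ln (fst p / real (card \<A>))\<bar>"
    have b: "?b = \<bar>ln ?\<alpha>\<bar> + ln ?n"
    proof -
      have "ln (?\<alpha> / ?n) = ln ?\<alpha> - ln ?n" using elim n by (simp add: ln_div)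
      moreover have "ln ?\<alpha> < 0" "0 \<le> ln ?n" using elim n by simp_all
      ultimately show ?thesis by simp
    qed
    have "0 \<le> ln ?n" using n by simp
    then have "c \<le> ?b" using elim b by linarith
    have "time_moment (law A) q (fst (gslrt_test p)) \<le> ennreal (s * (?b / J1 A) ^ q)"
      unfolding gslrt_def fst_conv by (rule c) fact
    also have "\<dots> \<le> ennreal (\<rho> * (\<bar>ln ?\<alpha>\<bar> / J1 A) ^ q)"
    proof (rule ennreal_leI)
      have "ln ?n \<le> \<bar>ln ?\<alpha>\<bar> * (s - 1)"
        by (rule pos_divide_le_eq[THEN iffD1]) (use s elim in simp_all)
      then have "?b \<le> s * \<bar>ln ?\<alpha>\<bar>" unfolding b by (simp add: algebra_simps)
      then have "?b / J1 A \<le> s * \<bar>ln ?\<alpha>\<bar> / J1 A"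
        by (rule divide_right_mono) (use J1_pos[OF A] in simp)
      then have "(?b / J1 A) ^ q \<le> (s * \<bar>ln ?\<alpha>\<bar> / J1 A) ^ q"
        by (rule power_mono) (use J1_pos[OF A] in simp)
      then have "s * (?b / J1 A) ^ q \<le> s * (s * \<bar>ln ?\<alpha>\<bar> / J1 A) ^ q"
        by (rule mult_left_mono) (use s in simp)
      also have "\<dots> = \<rho> * (\<bar>ln ?\<alpha>\<bar> / J1 A) ^ q"
        unfolding s_pow[symmetric] times_divide_eq_right[symmetric]
        by (simp only: power_mult_distrib power_Suc mult.assoc)
      finally show "s * (?b / J1 A) ^ q \<le> \<rho> * (\<bar>ln ?\<alpha>\<bar> / J1 A) ^ q" .
    qed
    finally show ?case .
  qed
qed

lemma error_class_bounds:
  assumes "(\<tau>, d) \<in> error_class K S P0 P1 \<A> \<alpha> \<beta>" "A \<in> \<A>"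
  shows "sequential_test K S (\<tau>, d)" and "\<P>(\<omega> in law {}. d \<omega> = Some 1) \<le> \<alpha>"
    and "\<P>(\<omega> in law A. d \<omega> = Some 0) \<le> \<beta>"
proof -
  have *: "sequential_test K S (\<tau>, d)" "\<P>(\<omega> in law {}. d \<omega> = Some 1) \<le> \<alpha>"
    "(MAX A\<in>\<A>. \<P>(\<omega> in law A. d \<omega> = Some 0)) \<le> \<beta>"
    using assms(1) unfolding error_class_def mem_Collect_eq prod.case by blast+
  show "sequential_test K S (\<tau>, d)" "\<P>(\<omega> in law {}. d \<omega> = Some 1) \<le> \<alpha>" by (rule *)+
  have "\<P>(\<omega> in law A. d \<omega> = Some 0) \<le> (MAX A\<in>\<A>. \<P>(\<omega> in law A. d \<omega> = Some 0))"
    using finite_family assms(2) by (intro Max_ge) auto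
  then show "\<P>(\<omega> in law A. d \<omega> = Some 0) \<le> \<beta>" using *(3) by (rule order_trans)
qed

text \<open>The best bound comes from the set \<open>A\<close> that is hardest to rule out under the null, the one that attains the minimum.\<close>

lemma optimum_null_lower:
  assumes \<rho>: "0 < \<rho>" "\<rho> < 1"
  shows "\<forall>\<^sub>F p in max_to_zero. ennreal (\<rho> * (\<bar>ln (snd p)\<bar> / J0) ^ q) \<le> optimum (law {}) q p"
proof -
  interpret prob_space "law {}" by (rule prob_law)
  obtain A where A: "A \<in> \<A>" "J0 = (\<Sum>k\<in>A. I0 k)" using J0_attained by blast
  have AK: "A \<subseteq> {1..K}" using family_subsets[OF A(1)] by blast
  have V: "(\<lambda>\<omega>. - ZA A n \<omega>) \<in> borel_measurable (law {})" for n
    using measurable_G_law[OF measurable_ZA, of A n "{}"] by (rule borel_measurable_uminus)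
  have "AE \<omega> in law {}. (\<lambda>n. - ZA A n \<omega> / real n) \<longlonglongrightarrow> J0"
    using transfer_ZA[OF AK lln_null[OF AK] empty_subsetI]
  proof eventually_elim
    case (elim \<omega>)
    from tendsto_minus[OF elim] show ?case by (simp add: A(2))
  qed
  from moment_lower[OF V this J0_pos \<rho>, of q]
  obtain \<epsilon> where \<epsilon>: "0 < \<epsilon>" and lower: "\<And>\<gamma> L \<tau>. \<gamma> \<le> \<epsilon> \<Longrightarrow> 1 / \<epsilon> \<le> L \<Longrightarrow>
      \<forall>n. {\<omega> \<in> space (law {}). \<tau> \<omega> \<le> enat n} \<in> events \<Longrightarrow>
      \<forall>n\<ge>1. \<forall>x. \<P>(\<omega> in law {}. \<tau> \<omega> \<le> enat n) \<le> \<gamma> + exp (x - L) + \<P>(\<omega> in law {}. x < - ZA A n \<omega>) \<Longrightarrow>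
      ennreal (\<rho> * (L / J0) ^ q) \<le> time_moment (law {}) q \<tau>"
    by blast
  from eventually_unit eventually_max_to_zero_le[OF \<epsilon>] eventually_ln_ge(2)[of "1 / \<epsilon>"]
  show ?thesis
  proof eventually_elim
    case (elim p)
    show ?case
    proof (rule INF_greatest, clarify)
      fix \<tau> d assume C: "(\<tau>, d) \<in> error_class K S P0 P1 \<A> (fst p) (snd p)"
      note test = error_class_bounds[OF C A(1)]
      have L: "exp (- \<bar>ln (snd p)\<bar>) = snd p" using elim by simp
      show "ennreal (\<rho> * (\<bar>ln (snd p)\<bar> / J0) ^ q) \<le> time_moment (law {}) q \<tau>"
      proof (rule lower)
        show "fst p \<le> \<epsilon>" "1 / \<epsilon> \<le> \<bar>ln (snd p)\<bar>" using elim by simp_all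
        show "\<forall>n. {\<omega> \<in> space (law {}). \<tau> \<omega> \<le> enat n} \<in> events"
          unfolding space_law by (intro allI sets_G_law[OF test_time_event[OF test(1)]])
        show "\<forall>n\<ge>1. \<forall>x. \<P>(\<omega> in law {}. \<tau> \<omega> \<le> enat n)
            \<le> fst p + exp (x - \<bar>ln (snd p)\<bar>) + \<P>(\<omega> in law {}. x < - ZA A n \<omega>)"
        proof (intro allI impI)
          fix n :: nat and x assume n: "1 \<le> n"
          have "exp x * \<P>(\<omega> in law A. d \<omega> = Some 0) \<le> exp x * exp (- \<bar>ln (snd p)\<bar>)"
            unfolding L by (rule mult_left_mono[OF test(3)]) simp
          also have "\<dots> = exp (x - \<bar>ln (snd p)\<bar>)"
            unfolding exp_add[symmetric] by simp
          finally show "\<P>(\<omega> in law {}. \<tau> \<omega> \<le> enat n)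
            \<le> fst p + exp (x - \<bar>ln (snd p)\<bar>) + \<P>(\<omega> in law {}. x < - ZA A n \<omega>)"
            using early_stopping_null[OF test(1) AK n, of x] test(2) by linarith
        qed
      qed
    qed
  qed
qed

lemma optimum_signal_lower:
  assumes A: "A \<in> \<A>" and \<rho>: "0 < \<rho>" "\<rho> < 1"
  shows "\<forall>\<^sub>F p in max_to_zero. ennreal (\<rho> * (\<bar>ln (fst p)\<bar> / J1 A) ^ q) \<le> optimum (law A) q p"
proof -
  interpret prob_space "law A" by (rule prob_law)
  have AK: "A \<subseteq> {1..K}" using family_subsets[OF A(1)] by blast
  have V: "ZA A n \<in> borel_measurable (law A)" for n
    by (rule measurable_G_law[OF measurable_ZA])
  have "AE \<omega> in law A. (\<lambda>n. ZA A n \<omega> / real n) \<longlonglongrightarrow> J1 A"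
    unfolding J1_def by (rule transfer_ZA[OF AK lln_signal[OF AK] AK])
  from moment_lower[OF V this J1_pos[OF A] \<rho>, of q]
  obtain \<epsilon> where \<epsilon>: "0 < \<epsilon>" and lower: "\<And>\<gamma> L \<tau>. \<gamma> \<le> \<epsilon> \<Longrightarrow> 1 / \<epsilon> \<le> L \<Longrightarrow>
      \<forall>n. {\<omega> \<in> space (law A). \<tau> \<omega> \<le> enat n} \<in> events \<Longrightarrow>
      \<forall>n\<ge>1. \<forall>x. \<P>(\<omega> in law A. \<tau> \<omega> \<le> enat n) \<le> \<gamma> + exp (x - L) + \<P>(\<omega> in law A. x < ZA A n \<omega>) \<Longrightarrow>
      ennreal (\<rho> * (L / J1 A) ^ q) \<le> time_moment (law A) q \<tau>"
    by blast
  from eventually_unit eventually_max_to_zero_le[OF \<epsilon>] eventually_ln_ge(1)[of "1 / \<epsilon>"]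
  show ?thesis
  proof eventually_elim
    case (elim p)
    show ?case
    proof (rule INF_greatest, clarify)
      fix \<tau> d assume C: "(\<tau>, d) \<in> error_class K S P0 P1 \<A> (fst p) (snd p)"
      note test = error_class_bounds[OF C A(1)]
      have L: "exp (- \<bar>ln (fst p)\<bar>) = fst p" using elim by simp
      show "ennreal (\<rho> * (\<bar>ln (fst p)\<bar> / J1 A) ^ q) \<le> time_moment (law A) q \<tau>"
      proof (rule lower)
        show "snd p \<le> \<epsilon>" "1 / \<epsilon> \<le> \<bar>ln (fst p)\<bar>" using elim by simp_all
        show "\<forall>n. {\<omega> \<in> space (law A). \<tau> \<omega> \<le> enat n} \<in> events"
          unfolding space_law by (intro allI sets_G_law[OF test_time_event[OF test(1)]])
        show "\<forall>n\<ge>1. \<forall>x. \<P>(\<omega> in law A. \<tau> \<omega> \<le> enat n)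
            \<le> snd p + exp (x - \<bar>ln (fst p)\<bar>) + \<P>(\<omega> in law A. x < ZA A n \<omega>)"
        proof (intro allI impI)
          fix n :: nat and x assume n: "1 \<le> n"
          have "exp x * \<P>(\<omega> in law {}. d \<omega> = Some 1) \<le> exp x * exp (- \<bar>ln (fst p)\<bar>)"
            unfolding L by (rule mult_left_mono[OF test(2)]) simp
          also have "\<dots> = exp (x - \<bar>ln (fst p)\<bar>)"
            unfolding exp_add[symmetric] by simp
          finally show "\<P>(\<omega> in law A. \<tau> \<omega> \<le> enat n)
            \<le> snd p + exp (x - \<bar>ln (fst p)\<bar>) + \<P>(\<omega> in law A. x < ZA A n \<omega>)"
            using early_stopping_signal[OF test(1) AK n, of x] test(3) by linarith
        qed
      qed
    qed
  qed
qed

lemma optimum_le_gslrt: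
  "\<forall>\<^sub>F p in max_to_zero. optimum M q p \<le> time_moment M q (fst (gslrt_test p))"
  using eventually_unit
proof eventually_elim
  case (elim p)
  have "gslrt_test p \<in> error_class K S P0 P1 \<A> (fst p) (snd p)"
    by (rule gslrt_in_error_class) (use elim in blast)+
  moreover have "(case gslrt_test p of (\<tau>, d) \<Rightarrow> time_moment M q \<tau>) = time_moment M q (fst (gslrt_test p))"
    by (rule case_prod_beta)
  ultimately show ?case
    using INF_lower[of "gslrt_test p" _ "\<lambda>(\<tau>, d). time_moment M q \<tau>"] by metis
qed

lemma ratio_equivs:
  assumes x: "\<forall>\<^sub>F p in max_to_zero. 0 < x p" and J: "0 < J"
    and upper: "\<And>\<rho>. 1 < \<rho> \<Longrightarrow> \<forall>\<^sub>F p in max_to_zero. time_moment M q (fst (gslrt_test p)) \<le> ennreal (\<rho> * (x p / J) ^ q)"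
    and lower: "\<And>\<rho>. 0 < \<rho> \<Longrightarrow> \<rho> < 1 \<Longrightarrow> \<forall>\<^sub>F p in max_to_zero. ennreal (\<rho> * (x p / J) ^ q) \<le> optimum M q p"
  shows "ratio_equiv max_to_zero (\<lambda>p. time_moment M q (fst (gslrt_test p))) (\<lambda>p. ennreal ((x p / J) ^ q))"
    and "ratio_equiv max_to_zero (\<lambda>p. ennreal ((x p / J) ^ q)) (optimum M q)"
proof -
  have pos: "\<forall>\<^sub>F p in max_to_zero. 0 < (x p / J) ^ q"
    using x by eventually_elim (use J in simp)
  show "ratio_equiv max_to_zero (\<lambda>p. time_moment M q (fst (gslrt_test p))) (\<lambda>p. ennreal ((x p / J) ^ q))"
  proof (rule ratio_equiv_squeeze(1)[OF pos upper])
    show "\<forall>\<^sub>F p in max_to_zero. ennreal (\<rho> * (x p / J) ^ q) \<le> time_moment M q (fst (gslrt_test p))"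
      if "0 < \<rho>" "\<rho> < 1" for \<rho>
      using lower[OF that] optimum_le_gslrt[of M q] by eventually_elim (rule order_trans)
  qed
  show "ratio_equiv max_to_zero (\<lambda>p. ennreal ((x p / J) ^ q)) (optimum M q)"
  proof (rule ratio_equiv_squeeze(2)[OF pos _ lower])
    show "\<forall>\<^sub>F p in max_to_zero. optimum M q p \<le> ennreal (\<rho> * (x p / J) ^ q)" if "1 < \<rho>" for \<rho>
      using upper[OF that] optimum_le_gslrt[of M q] by eventually_elim (rule order_trans[rotated])
  qed
qed

lemma ln_pos_max_to_zero:
  "\<forall>\<^sub>F p in max_to_zero. 0 < \<bar>ln (fst p)\<bar>" "\<forall>\<^sub>F p in max_to_zero. 0 < \<bar>ln (snd p)\<bar>"
  by (rule eventually_mono[OF eventually_ln_ge(1)[of 1]] eventually_mono[OF eventually_ln_ge(2)[of 1]],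
      linarith)+

end

section \<open>Asymptotic optimality of the G-SLRT\<close>

theorem mainTheorem3:
  fixes K :: nat
    and S :: "nat \<Rightarrow> 'a measure"
    and P0 P1 :: "nat \<Rightarrow> (nat \<Rightarrow> 'a) measure"
    and I0 I1 :: "nat \<Rightarrow> real"
    and \<A> :: "nat set set"
    and q :: nat
  assumes prob0: "\<And>k. k \<in> {1..K} \<Longrightarrow> prob_space (P0 k)"
    and prob1: "\<And>k. k \<in> {1..K} \<Longrightarrow> prob_space (P1 k)"
    and sets0: "\<And>k. k \<in> {1..K} \<Longrightarrow> sets (P0 k) = sets (path_space (S k))"
    and sets1: "\<And>k. k \<in> {1..K} \<Longrightarrow> sets (P1 k) = sets (path_space (S k))"
    and distinct: "\<And>k. k \<in> {1..K} \<Longrightarrow> P0 k \<noteq> P1 k"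
    and ac01: "\<And>k t. k \<in> {1..K} \<Longrightarrow> 1 \<le> t \<Longrightarrow>
      absolutely_continuous (restr_to_subalg (P0 k) (local_filtration (S k) t))
                            (restr_to_subalg (P1 k) (local_filtration (S k) t))"
    and ac10: "\<And>k t. k \<in> {1..K} \<Longrightarrow> 1 \<le> t \<Longrightarrow>
      absolutely_continuous (restr_to_subalg (P1 k) (local_filtration (S k) t))
                            (restr_to_subalg (P0 k) (local_filtration (S k) t))"
    and family_nonempty: "\<A> \<noteq> {}"
    and family_subsets: "\<And>A. A \<in> \<A> \<Longrightarrow> A \<noteq> {} \<and> A \<subseteq> {1..K}"
    and indep0: "\<And>k. k \<in> {1..K} \<Longrightarrow>
      prob_space.indep_vars (P0 k) (\<lambda>_. borel) (llr_increment (S k) (P0 k) (P1 k)) {1..}"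
    and indep1: "\<And>k. k \<in> {1..K} \<Longrightarrow>
      prob_space.indep_vars (P1 k) (\<lambda>_. borel) (llr_increment (S k) (P0 k) (P1 k)) {1..}"
    and I0_pos: "\<And>k. k \<in> {1..K} \<Longrightarrow> 0 < I0 k"
    and I1_pos: "\<And>k. k \<in> {1..K} \<Longrightarrow> 0 < I1 k"
    and lln1: "\<And>k. k \<in> {1..K} \<Longrightarrow>
      AE x in P1 k. (\<lambda>t. local_llr (S k) (P0 k) (P1 k) t x / real t) \<longlonglongrightarrow> I1 k"
    and lln0: "\<And>k. k \<in> {1..K} \<Longrightarrow>
      AE x in P0 k. (\<lambda>t. local_llr (S k) (P0 k) (P1 k) t x / real t) \<longlonglongrightarrow> - I0 k"
    and q_pos: "1 \<le> q"
  shows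
    "ratio_equiv max_to_zero
       (\<lambda>(\<alpha>, \<beta>). time_moment (joint_law K P0 P1 {}) q
          (fst (gslrt K S P0 P1 \<A> \<bar>ln \<beta>\<bar> \<bar>ln (\<alpha> / real (card \<A>))\<bar>)))
       (\<lambda>(\<alpha>, \<beta>). ennreal ((\<bar>ln \<beta>\<bar> / (MIN A\<in>\<A>. \<Sum>k\<in>A. I0 k)) ^ q))
     \<and>
     ratio_equiv max_to_zero
       (\<lambda>(\<alpha>, \<beta>). ennreal ((\<bar>ln \<beta>\<bar> / (MIN A\<in>\<A>. \<Sum>k\<in>A. I0 k)) ^ q))
       (\<lambda>(\<alpha>, \<beta>). INF (\<tau>, d) \<in> error_class K S P0 P1 \<A> \<alpha> \<beta>.
          time_moment (joint_law K P0 P1 {}) q \<tau>)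
     \<and>
     (\<forall>A\<in>\<A>.
       ratio_equiv max_to_zero
         (\<lambda>(\<alpha>, \<beta>). time_moment (joint_law K P0 P1 A) q
            (fst (gslrt K S P0 P1 \<A> \<bar>ln \<beta>\<bar> \<bar>ln (\<alpha> / real (card \<A>))\<bar>)))
         (\<lambda>(\<alpha>, \<beta>). ennreal ((\<bar>ln \<alpha>\<bar> / (\<Sum>k\<in>A. I1 k)) ^ q))
       \<and>
       ratio_equiv max_to_zero
         (\<lambda>(\<alpha>, \<beta>). ennreal ((\<bar>ln \<alpha>\<bar> / (\<Sum>k\<in>A. I1 k)) ^ q))
         (\<lambda>(\<alpha>, \<beta>). INF (\<tau>, d) \<in> error_class K S P0 P1 \<A> \<alpha> \<beta>.
            time_moment (joint_law K P0 P1 A) q \<tau>))"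
proof -
  interpret multichannel K S P0 P1 \<A> I0 I1
    by (intro multichannel.intro channels_indep.intro channels.intro channel_family.intro
        channels_indep_axioms.intro channel_family_axioms.intro multichannel_axioms.intro)
      (fact prob0 prob1 sets0 sets1 ac01 ac10 indep0 indep1 family_nonempty family_subsets I0_pos I1_pos lln1 lln0)+
  have null: "ratio_equiv max_to_zero (\<lambda>p. time_moment (law {}) q (fst (gslrt_test p)))
        (\<lambda>p. ennreal ((\<bar>ln (snd p)\<bar> / J0) ^ q))"
      "ratio_equiv max_to_zero (\<lambda>p. ennreal ((\<bar>ln (snd p)\<bar> / J0) ^ q)) (optimum (law {}) q)"
    by (rule ratio_equivs[OF ln_pos_max_to_zero(2) J0_pos
          gslrt_null_upper[OF _ q_pos] optimum_null_lower]; assumption)+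
  have signal: "ratio_equiv max_to_zero (\<lambda>p. time_moment (law A) q (fst (gslrt_test p)))
        (\<lambda>p. ennreal ((\<bar>ln (fst p)\<bar> / J1 A) ^ q))"
      "ratio_equiv max_to_zero (\<lambda>p. ennreal ((\<bar>ln (fst p)\<bar> / J1 A) ^ q)) (optimum (law A) q)"
    if "A \<in> \<A>" for A
    by (rule ratio_equivs[OF ln_pos_max_to_zero(1) J1_pos[OF that]
          gslrt_signal_upper[OF that _ q_pos] optimum_signal_lower[OF that]]; assumption)+
  show ?thesis
    using null signal unfolding J0_def J1_def split_def by blast
qed

end
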